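(* Let $k$ be a field, $S=k[T_1,\ldots,T_n]$ and $\mathfrak{n}=(T_1,\ldots,T_n)$. Let $I$ be a non-principal homogeneous ideal such that $I\subseteq\mathfrak{n}^2$, and let $R=S/I$. If $R$ is a Golod ring, then there exists a real number $\rho>1$ such that $$\varepsilon_i(R)\sim\frac{\rho^i}{i},$$ that is, $\lim_{i\to\infty}\dfrac{\varepsilon_i(R)}{\rho^i/i}=1$.
   Context: The polynomial ring $S=k[T_1,\ldots,T_n]$ is standard graded ($\deg T_j=1$). Deviations: for $R=S/I$ with $I\subseteq\mathfrak{n}^2$ a homogeneous ideal, put $\beta_i^R(k)=\dim_k \mathrm{Tor}_i^R(k,k)$ and let $P_k^R(z)=\sum_{i\geqslant 0}\beta_i^R(k)z^i$ be the Poincaré series of $k$ over $R$. The deviations $\varepsilon_i=\varepsilon_i(R)$, $i\geqslant 1$, are the uniquely determined integers such that $$P_k^R(z)=\prod_{i=1}^\infty \frac{(1+z^{2i-1})^{\varepsilon_{2i-1}}}{(1-z^{2i})^{\varepsilon_{2i}}}$$ as formal power series. Golod rings: let $\beta_i^S(R)=\dim_k\mathrm{Tor}_i^S(R,k)$. The ring $R=S/I$ (with $I\subseteq\mathfrak{n}^2$ homogeneous) is called Golod if $$P_k^R(z)=\frac{(1+z)^n}{1-\sum_{i=1}^n\beta_i^S(R)z^{i+1}},$$ i.e. if equality holds in Serre's coefficientwise upper bound for $P_k^R(z)$. *)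

theory Defs
  imports
    "HOL-Algebra.Ideal_Product"
    "HOL-Algebra.QuotRing"
    "HOL-Algebra.Module"
    "HOL-Algebra.Algebraic_Closure_Type"
    "HOL-Library.Poly_Mapping"
    "HOL-Library.Cardinality"
    "HOL-Library.Function_Algebras"
    "HOL-Computational_Algebra.Formal_Power_Series"
begin

section \<open>The polynomial ring and its ideals\<close>

text \<open>
  The variables are indexed by a finite type \<open>'n\<close>, so \<open>n = CARD('n)\<close>.  A polynomial is a finitely
  supported map from exponent vectors to coefficients, with the convolution product.
\<close>

type_synonym ('n, 'k) mpoly = "('n \<Rightarrow>\<^sub>0 nat) \<Rightarrow>\<^sub>0 'k"

abbreviation mpoly_ring :: "('n::finite, 'k::field) mpoly ring" where
  "mpoly_ring \<equiv> ring_of_type_algebra"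

definition indet :: "'n \<Rightarrow> ('n::finite, 'k::field) mpoly" where
  "indet j = Poly_Mapping.single (Poly_Mapping.single j 1) 1"

definition irrelevant_ideal :: "('n::finite, 'k::field) mpoly set" where
  "irrelevant_ideal = genideal mpoly_ring (range indet)"

definition total_degree :: "('n::finite \<Rightarrow>\<^sub>0 nat) \<Rightarrow> nat" where
  "total_degree m = (\<Sum>j\<in>UNIV. Poly_Mapping.lookup m j)"

definition hom_component :: "nat \<Rightarrow> ('n::finite, 'k::field) mpoly \<Rightarrow> ('n, 'k) mpoly" where
  "hom_component d f =
    (\<Sum>m\<in>{m \<in> Poly_Mapping.keys f. total_degree m = d}.
      Poly_Mapping.single m (Poly_Mapping.lookup f m))"

definition homogeneous_ideal :: "('n::finite, 'k::field) mpoly set \<Rightarrow> bool" where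
  "homogeneous_ideal I \<longleftrightarrow> ideal I mpoly_ring \<and> (\<forall>f\<in>I. \<forall>d. hom_component d f \<in> I)"


section \<open>Free resolutions and Tor\<close>

text \<open>
  For a module \<open>N\<close> the direct sum \<open>N\<^sup>b\<close> consists of the sequences in \<open>N\<close> vanishing from index \<open>b\<close> on,
  and an \<open>r \<times> c\<close> matrix \<open>A\<close> over the base ring acts as a map from \<open>N\<^sup>c\<close> to \<open>N\<^sup>r\<close>.
\<close>

definition dsum :: "('r, 'm, 'y) module_scheme \<Rightarrow> nat \<Rightarrow> (nat \<Rightarrow> 'm) set" where
  "dsum N b = {v. (\<forall>p<b. v p \<in> carrier N) \<and> (\<forall>p\<ge>b. v p = \<zero>\<^bsub>N\<^esub>)}"

definition mat_act ::
  "('r, 'm, 'y) module_scheme \<Rightarrow> nat \<Rightarrow> nat \<Rightarrow> (nat \<Rightarrow> nat \<Rightarrow> 'r) \<Rightarrow> (nat \<Rightarrow> 'm) \<Rightarrow> nat \<Rightarrow> 'm" where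
  "mat_act N r c A v =
    (\<lambda>p. if p < r then finsum N (\<lambda>q. A p q \<odot>\<^bsub>N\<^esub> v q) {..<c} else \<zero>\<^bsub>N\<^esub>)"

text \<open>
  Let \<open>F\<close> be the complex of free \<open>R\<close>-modules with \<open>F\<^sub>i = R\<^bsup>b i\<^esup>\<close> whose differential from
  \<open>F\<^sub>i\<^sub>+\<^sub>1\<close> to \<open>F\<^sub>i\<close> is given by the matrix \<open>D i\<close>.  Identifying \<open>R\<^sup>b \<otimes>\<^sub>R N\<close> with \<open>N\<^sup>b\<close>, the following
  are the cycles and the boundaries of \<open>F \<otimes>\<^sub>R N\<close> in degree \<open>i\<close>.
\<close>

definition cycles ::
  "('r, 'm, 'y) module_scheme \<Rightarrow> (nat \<Rightarrow> nat) \<Rightarrow> (nat \<Rightarrow> nat \<Rightarrow> nat \<Rightarrow> 'r) \<Rightarrow> nat \<Rightarrow> (nat \<Rightarrow> 'm) set" where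
  "cycles N b D i =
    (case i of 0 \<Rightarrow> dsum N (b 0)
     | Suc j \<Rightarrow> {v \<in> dsum N (b (Suc j)). mat_act N (b j) (b (Suc j)) (D j) v = (\<lambda>_. \<zero>\<^bsub>N\<^esub>)})"

definition boundaries ::
  "('r, 'm, 'y) module_scheme \<Rightarrow> (nat \<Rightarrow> nat) \<Rightarrow> (nat \<Rightarrow> nat \<Rightarrow> nat \<Rightarrow> 'r) \<Rightarrow> nat \<Rightarrow> (nat \<Rightarrow> 'm) set" where
  "boundaries N b D i = mat_act N (b i) (b (Suc i)) (D i) ` dsum N (b (Suc i))"

definition regular_module :: "('r, 'x) ring_scheme \<Rightarrow> ('r, 'r) module" where
  "regular_module R =
    \<lparr>carrier = carrier R, monoid.mult = monoid.mult R, one = one R, zero = zero R,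
     add = add R, module.smult = monoid.mult R\<rparr>"

definition augmentation ::
  "('r, 'm, 'y) module_scheme \<Rightarrow> nat \<Rightarrow> (nat \<Rightarrow> 'm) \<Rightarrow> (nat \<Rightarrow> 'r) \<Rightarrow> 'm" where
  "augmentation M c e v = finsum M (\<lambda>q. v q \<odot>\<^bsub>M\<^esub> e q) {..<c}"

text \<open>
  A resolution of \<open>M\<close> by free \<open>R\<close>-modules of finite rank; \<open>e\<close> lists the images in \<open>M\<close> of the
  basis of \<open>F\<^sub>0\<close>.
\<close>

definition free_resolution ::
  "('r, 'x) ring_scheme \<Rightarrow> ('r, 'm, 'y) module_scheme \<Rightarrow>
    (nat \<Rightarrow> nat) \<Rightarrow> (nat \<Rightarrow> nat \<Rightarrow> nat \<Rightarrow> 'r) \<Rightarrow> (nat \<Rightarrow> 'm) \<Rightarrow> bool" where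
  "free_resolution R M b D e \<longleftrightarrow>
    (\<forall>i. \<forall>p<b i. \<forall>q<b (Suc i). D i p q \<in> carrier R) \<and>
    (\<forall>q<b 0. e q \<in> carrier M) \<and>
    augmentation M (b 0) e ` dsum (regular_module R) (b 0) = carrier M \<and>
    {v \<in> dsum (regular_module R) (b 0). augmentation M (b 0) e v = \<zero>\<^bsub>M\<^esub>}
      = boundaries (regular_module R) b D 0 \<and>
    (\<forall>i. cycles (regular_module R) b D (Suc i) = boundaries (regular_module R) b D (Suc i))"

text \<open>The field \<open>k\<close> as an \<open>R\<close>-module through a ring homomorphism \<open>\<chi>\<close> from \<open>R\<close> to \<open>k\<close>.\<close>

definition field_module :: "('r \<Rightarrow> 'k::field) \<Rightarrow> ('r, 'k) module" where
  "field_module \<chi> =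
    \<lparr>carrier = UNIV, monoid.mult = (*), one = 1, zero = 0, add = (+), module.smult = (\<lambda>a x. \<chi> a * x)\<rparr>"

definition kdim :: "(nat \<Rightarrow> 'k::field) set \<Rightarrow> nat" where
  "kdim V = vector_space.dim (\<lambda>c v i. c * v i) V"

text \<open>
  The dimension over \<open>k\<close> of \<open>Tor\<^sub>i\<^sup>R(M,k) = H\<^sub>i(F \<otimes>\<^sub>R k)\<close>, where \<open>F\<close> is a chosen free resolution of \<open>M\<close>.
  It does not depend on the choice.  A resolution by free modules of finite rank exists
  for every finitely generated module over a Noetherian ring, hence in all cases used below.  The
  cycles are then a finite-dimensional space containing the boundaries, so the dimension of the
  homology is the difference of the two dimensions.
\<close>

definition tor_dim ::
  "('r, 'x) ring_scheme \<Rightarrow> ('r, 'm, 'y) module_scheme \<Rightarrow> ('r \<Rightarrow> 'k::field) \<Rightarrow> nat \<Rightarrow> nat" where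
  "tor_dim R M \<chi> i =
    (let (b, D, e) = (SOME (b, D, e). free_resolution R M b D e)
     in kdim (cycles (field_module \<chi>) b D i) - kdim (boundaries (field_module \<chi>) b D i))"


section \<open>Betti numbers, deviations and Golod rings\<close>

definition residue_map :: "('n::finite, 'k::field) mpoly \<Rightarrow> 'k" where
  "residue_map f = Poly_Mapping.lookup f 0"

text \<open>
  The map induced by \<^const>\<open>residue_map\<close> on cosets of \<open>I\<close>; all polynomials in a coset have the same
  constant coefficient when \<open>I\<close> is contained in the irrelevant ideal.
\<close>

definition quot_residue_map :: "('n::finite, 'k::field) mpoly set \<Rightarrow> 'k" where
  "quot_residue_map C = the_elem (residue_map ` C)"

definition quotient_module :: "('r, 'x) ring_scheme \<Rightarrow> 'r set \<Rightarrow> ('r, 'r set) module" where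
  "quotient_module R I =
    \<lparr>carrier = carrier (R Quot I), monoid.mult = monoid.mult (R Quot I), one = one (R Quot I),
     zero = zero (R Quot I), add = add (R Quot I),
     module.smult = (\<lambda>a C. (I +>\<^bsub>R\<^esub> a) \<otimes>\<^bsub>R Quot I\<^esub> C)\<rparr>"

text \<open>Below, \<open>I\<close> is a proper homogeneous ideal of \<open>S = k[T\<^sub>1,\<dots>,T\<^sub>n]\<close> and \<open>R = S/I\<close>.\<close>

text \<open>\<open>\<beta>\<^sub>i\<^sup>S(R)\<close>, the dimension of \<open>Tor\<^sub>i\<^sup>S(R,k)\<close>\<close>

definition betti_over_poly :: "('n::finite, 'k::field) mpoly set \<Rightarrow> nat \<Rightarrow> nat" where
  "betti_over_poly I i =
    tor_dim mpoly_ring (quotient_module mpoly_ring I) (residue_map :: ('n, 'k) mpoly \<Rightarrow> 'k) i"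

text \<open>\<open>\<beta>\<^sub>i\<^sup>R(k)\<close>, the dimension of \<open>Tor\<^sub>i\<^sup>R(k,k)\<close>\<close>

definition betti_residue_field :: "('n::finite, 'k::field) mpoly set \<Rightarrow> nat \<Rightarrow> nat" where
  "betti_residue_field I i =
    tor_dim (mpoly_ring Quot I)
      (field_module (quot_residue_map :: ('n, 'k) mpoly set \<Rightarrow> 'k))
      (quot_residue_map :: ('n, 'k) mpoly set \<Rightarrow> 'k) i"

definition poincare_series :: "('n::finite, 'k::field) mpoly set \<Rightarrow> real fps" where
  "poincare_series I = Abs_fps (\<lambda>i. real (betti_residue_field I i))"

text \<open>
  The infinite product is the limit of its partial products in the \<open>X\<close>-adic topology on
  formal power series.
\<close>

definition has_deviations :: "real fps \<Rightarrow> (nat \<Rightarrow> int) \<Rightarrow> bool" where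
  "has_deviations P \<epsilon> \<longleftrightarrow>
    (\<lambda>N. \<Prod>i=1..N. (1 + fps_X ^ (2 * i - 1)) powi \<epsilon> (2 * i - 1) / (1 - fps_X ^ (2 * i)) powi \<epsilon> (2 * i))
      \<longlonglongrightarrow> P"

text \<open>The deviations are indexed by \<open>i \<ge> 1\<close>; the value at \<open>0\<close> is set to \<open>0\<close> to make them unique.\<close>

definition deviation :: "('n::finite, 'k::field) mpoly set \<Rightarrow> nat \<Rightarrow> int" where
  "deviation I = (THE \<epsilon>. \<epsilon> 0 = 0 \<and> has_deviations (poincare_series I) \<epsilon>)"

definition golod :: "('n::finite, 'k::field) mpoly set \<Rightarrow> bool" where
  "golod I \<longleftrightarrow>
    poincare_series I =
      (1 + fps_X) ^ CARD('n) /
      (1 - (\<Sum>i=1..CARD('n). fps_const (real (betti_over_poly I i)) * fps_X ^ (i + 1)))"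

end

theory Submission
  imports Defs
begin

text \<open>
For a Golod ring the Poincare series of \<open>k\<close> over \<open>R\<close> is \<open>P(z) = (1 + z)\<^sup>n / D(z)\<close> with
\<open>D(z) = 1 - \<Sum> \<beta>\<^sub>i z\<^sup>i\<^sup>+\<^sup>1\<close> and \<open>\<beta>\<^sub>i = \<beta>\<^sub>i\<^sup>S(R)\<close>.  The ring itself matters only through three facts:
\<open>n \<ge> 2\<close>, \<open>\<beta>\<^sub>1 > 0\<close> and \<open>\<beta>\<^sub>2 > 0\<close>.

Given these, compare \<open>z P'/P\<close> on both sides of the product formula that defines the deviations.  On
the product side, the coefficient of \<open>z\<^sup>m\<close> is a sum of terms \<open>\<plusminus> j \<epsilon>\<^sub>j\<close> over the divisors \<open>j\<close> of
\<open>m\<close>.  All divisors other than \<open>m\<close> are at most \<open>m/2\<close>, so \<open>m \<epsilon>\<^sub>m\<close> differs from the coefficient by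
a quantity of exponential growth rate at most the square root of the main one
(\<open>asymptotics_of_self_bounded_perturbation\<close>).  On the other side, the coefficients \<open>p\<^sub>m\<close> of
\<open>- z D'/D\<close> satisfy \<open>p\<^sub>m = m \<beta>\<^sub>m\<^sub>-\<^sub>1 + \<Sum>\<^sub>j \<beta>\<^sub>j\<^sub>-\<^sub>1 p\<^sub>m\<^sub>-\<^sub>j\<close>.  Let \<open>r\<close> be the root of
\<open>\<Sum> \<beta>\<^sub>j\<^sub>-\<^sub>1 r\<^sup>j = 1\<close> in \<open>(0,1)\<close>, which exists because \<open>\<beta>\<^sub>1 + \<beta>\<^sub>2 \<ge> 2\<close>.  Then \<open>p\<^sub>m r\<^sup>m\<close> solves a renewal
equation with weights \<open>\<beta>\<^sub>j\<^sub>-\<^sub>1 r\<^sup>j\<close> of total mass one.  The lags 2 and 3 both have positive weight and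
are coprime, so \<open>p\<^sub>m r\<^sup>m\<close> tends to 1 (\<open>renewal_limit\<close>), and \<open>\<rho> = 1/r\<close>.

The Betti numbers are those of a resolution by free modules of finite rank about which nothing more
is known, so two things are needed: such a resolution exists, which is the Noetherian property
(\<open>submod_finitely_generated\<close>, by leading terms and Dickson's lemma), and for every such resolution,
minimal or not, the homology of \<open>F \<otimes> k\<close> is nonzero in degrees 1 and 2 (\<open>tor_nonzero\<close>).  For the
latter, let \<open>\<nn>\<close> be the irrelevant ideal.  The graded Nakayama lemma yields \<open>f, g \<in> I\<close> linearly independent modulo \<open>\<nn> I\<close>, since \<open>I\<close> is
homogeneous and not principal.  Lifting \<open>f\<close> along \<open>F\<^sub>1 \<rightarrow> I\<close> gives a class in degree 1.  If the
homology in degree 2 were zero, then every second syzygy without constant terms would lie in \<open>\<nn>\<close> times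
the syzygies; the syzygies would behave like a direct summand of \<open>F\<^sub>1\<close> near the origin, and \<open>I\<close> like a
free module.  This contradicts the Koszul relation \<open>g \<cdot> f - f \<cdot> g = 0\<close> between the independent
elements \<open>f\<close> and \<open>g\<close>.  Finally \<open>n \<ge> 2\<close> since homogeneous ideals in one variable are principal.
\<close>

section \<open>Renewal sequences\<close>

text \<open>
The maximum of \<open>u\<close> over a window of \<open>N + 1\<close> consecutive indices is nonincreasing in the position of
the window and tends to some \<open>L\<close>; in particular every window contains a value of at least \<open>L\<close>.  A
value close to the maximum forces the values two and three steps before it to be close as well, with
a loss by a bounded factor.  As every number except 1 is a sum of twos and threes, closeness to
\<open>L\<close> propagates from one large value per window to all indices.
\<close>

lemma renewal_converges:
  fixes f u :: "nat \<Rightarrow> real"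
  assumes nonneg: "\<And>j. f j \<ge> 0" and f2: "f 2 > 0" and f3: "f 3 > 0"
    and total: "(\<Sum>j=1..N. f j) = 1" and N: "N \<ge> 3"
    and u_nonneg: "\<And>m. u m \<ge> 0"
    and rec: "\<And>m. m > N \<Longrightarrow> u m = (\<Sum>j=1..N. f j * u (m - j))"
  shows "convergent u"
proof -
  define W where "W m = Max (u ` {m..m+N})" for m
  have W_upper: "u k \<le> W m" if "m \<le> k" "k \<le> m + N" for k m
    unfolding W_def using that by (intro Max_ge) auto
  have W_attained: "\<exists>k. m \<le> k \<and> k \<le> m + N \<and> u k = W m" for m
  proof -
    have "W m \<in> u ` {m..m+N}" unfolding W_def by (intro Max_in) auto
    then show ?thesis by auto
  qed
  have W_Suc: "W (Suc m) \<le> W m" for m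
  proof -
    obtain k where k: "Suc m \<le> k" "k \<le> Suc m + N" "u k = W (Suc m)" using W_attained by blast
    show ?thesis
    proof (cases "k \<le> m + N")
      case True then show ?thesis using k W_upper[of m k] by simp
    next
      case False
      then have kk: "k = m + N + 1" using k by simp
      have "u k = (\<Sum>j=1..N. f j * u (k - j))" using rec[of k] kk by simp
      also have "\<dots> \<le> (\<Sum>j=1..N. f j * W m)"
        using kk by (intro sum_mono mult_left_mono W_upper nonneg) auto
      also have "\<dots> = W m" using total by (simp flip: sum_distrib_right)
      finally show ?thesis using k by simp
    qed
  qed
  then have dec: "decseq W" by (simp add: decseq_Suc_iff)
  have "0 \<le> W m" for m using W_attained[of m] u_nonneg by metis
  then obtain L where L: "W \<longlonglongrightarrow> L" and LW: "\<And>m. L \<le> W m"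
    using decseq_convergent[OF dec, of 0] by blast
  define \<delta> where "\<delta> = min (f 2) (f 3)"
  have d0: "\<delta> > 0" using f2 f3 by (simp add: \<delta>_def)
  have f_le: "f j \<le> 1" if "j \<in> {1..N}" for j
  proof -
    have "f j \<le> (\<Sum>j=1..N. f j)" using that nonneg by (intro member_le_sum) auto
    then show ?thesis using total by simp
  qed
  have d1: "\<delta> \<le> 1" using f_le[of 2] N by (simp add: \<delta>_def min_le_iff_disj)
  have "u \<longlonglongrightarrow> L"
  proof (rule LIMSEQ_I)
    fix e :: real assume e: "e > 0"
    \<comment> \<open>At most \<open>N + 2\<close> steps back are taken below, each of which may divide the distance by \<open>\<delta>\<close>.\<close>
    define \<epsilon> where "\<epsilon> = e * \<delta> ^ (N + 2) / 2"
    have eps: "\<epsilon> > 0" using e d0 by (simp add: \<epsilon>_def)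
    obtain m0 where m0: "\<And>m. m \<ge> m0 \<Longrightarrow> \<bar>W m - L\<bar> < \<epsilon>" 
      using LIMSEQ_D[OF L eps] by (auto simp: real_norm_def)
    have up: "u m \<le> L + \<epsilon>" if "m \<ge> m0" for m
      using W_upper[of m m] m0[OF that] by simp
    \<comment> \<open>a value close to the upper bound forces the values two and three steps earlier to be close to it\<close>
    have step: "(L + \<epsilon>) - u (m - i) \<le> c / \<delta>"
      if i: "i = 2 \<or> i = 3" and m: "m > m0 + N" and c: "(L + \<epsilon>) - u m \<le> c" for m i c
    proof -
      have iN: "i \<in> {1..N}" and fi: "\<delta> \<le> f i" using i N by (auto simp: \<delta>_def)
      have "f i * ((L + \<epsilon>) - u (m - i)) \<le> (\<Sum>j=1..N. f j * ((L + \<epsilon>) - u (m - j)))"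
        using m by (intro member_le_sum[OF iN]) (auto intro!: mult_nonneg_nonneg nonneg up)
      also have "\<dots> = (L + \<epsilon>) * (\<Sum>j=1..N. f j) - (\<Sum>j=1..N. f j * u (m - j))"
        by (simp add: right_diff_distrib sum_subtractf sum_distrib_left sum_distrib_right mult.commute)
      also have "\<dots> = (L + \<epsilon>) - u m" using total rec[of m] m by simp
      finally have 1: "f i * ((L + \<epsilon>) - u (m - i)) \<le> c" using c by simp
      have "u (m - i) \<le> L + \<epsilon>" using m i N by (intro up) auto
      then have "\<delta> * ((L + \<epsilon>) - u (m - i)) \<le> f i * ((L + \<epsilon>) - u (m - i))"
        using fi by (intro mult_right_mono) auto
      with 1 have "((L + \<epsilon>) - u (m - i)) * \<delta> \<le> c" by (simp only: mult.commute)
      then show ?thesis by (simp only: pos_le_divide_eq[OF d0])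
    qed
    have steps: "(L + \<epsilon>) - u (m - t) \<le> c / \<delta> ^ t"
      if "t \<noteq> 1" "m > m0 + N + t" "(L + \<epsilon>) - u m \<le> c" "c \<ge> 0" for t m c
      using that
    proof (induction t arbitrary: m c rule: less_induct)
      case (less t)
      have dec_pow: "c / \<delta> \<le> c / \<delta> ^ t" if "t \<ge> 1"
        using that d0 d1 less.prems(4) power_decreasing[of 1 t \<delta>]
        by (intro divide_left_mono) auto
      consider "t = 0" | "t = 2 \<or> t = 3" | "t \<ge> 4" using less.prems(1) by linarith
      then show ?case
      proof cases
        case 1 then show ?thesis using less.prems by simp
      next
        case 2
        then have "(L + \<epsilon>) - u (m - t) \<le> c / \<delta>" using less.prems by (intro step[of t m c]) simp_all
        moreover have "t \<ge> 1" using 2 by auto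
        ultimately show ?thesis using dec_pow by linarith
      next
        case 3
        have "m > m0 + N" using less.prems(2) by simp
        then have "(L + \<epsilon>) - u (m - 2) \<le> c / \<delta>" using less.prems(3) by (intro step[of 2 m c]) simp_all
        then have "(L + \<epsilon>) - u (m - 2 - (t - 2)) \<le> (c / \<delta>) / \<delta> ^ (t - 2)"
          using 3 less.prems d0 by (intro less.IH) simp_all
        also have "\<dots> = c / \<delta> ^ (t - 1)"
        proof -
          have "t - 1 = Suc (t - 2)" using 3 by simp
          then show ?thesis by simp
        qed
        also have "\<dots> \<le> c / \<delta> ^ t" 
          using d0 d1 less.prems(4) power_decreasing[of "t - 1" t \<delta>] by (intro divide_left_mono) auto
        finally have "L + \<epsilon> - u (m - 2 - (t - 2)) \<le> c / \<delta> ^ t" .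
        moreover have "m - 2 - (t - 2) = m - t" using 3 by simp
        ultimately show ?thesis by (simp only:)
      qed
    qed
    have low: "L + \<epsilon> - u m \<le> e / 2" if m: "m > m0 + N" for m
    proof -
      \<comment> \<open>The window starts at \<open>m + 2\<close> so that the distance \<open>k - m\<close> is not 1.\<close>
      obtain k where k: "m + 2 \<le> k" "k \<le> m + 2 + N" "u k = W (m + 2)" using W_attained by blast
      have "(L + \<epsilon>) - u (k - (k - m)) \<le> \<epsilon> / \<delta> ^ (k - m)"
        using k m LW[of "m + 2"] eps by (intro steps) auto
      also have "\<dots> \<le> \<epsilon> / \<delta> ^ (N + 2)"
        using k d0 d1 eps power_decreasing[of "k - m" "N + 2" \<delta>] by (intro divide_left_mono) auto
      also have "\<dots> = e / 2" using d0 by (simp add: \<epsilon>_def)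
      finally show ?thesis using k by simp
    qed
    have "\<delta> ^ (N + 2) \<le> 1" using d0 d1 by (intro power_le_one) auto
    then have "\<epsilon> \<le> e / 2" using e by (simp add: \<epsilon>_def mult_le_cancel_left1)
    then have "norm (u m - L) < e" if "m \<ge> m0 + N + 1" for m
      using low[of m] up[of m] that e eps by (auto simp: abs_if)
    then show "\<exists>no. \<forall>m\<ge>no. norm (u m - L) < e" by blast
  qed
  then show ?thesis by (rule convergentI)
qed

text \<open>
The limit is found from a conserved quantity.  Let \<open>F k\<close> be the weight of the lags beyond \<open>k\<close>.
The sum of the products \<open>F k * u (m - k)\<close> grows by exactly \<open>m * f m\<close> when \<open>m\<close> is reached, hence
eventually equals the mean lag \<open>\<mu>\<close>; it also tends to \<open>\<mu>\<close> times the limit of \<open>u\<close>.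
\<close>

lemma renewal_limit:
  fixes f u :: "nat \<Rightarrow> real"
  assumes nonneg: "\<And>j. f j \<ge> 0" and f2: "f 2 > 0" and f3: "f 3 > 0"
    and total: "(\<Sum>j=1..N. f j) = 1" and N: "N \<ge> 3"
    and supp: "\<And>j. j > N \<Longrightarrow> f j = 0"
    and rec: "\<And>m. u m = real m * f m + (\<Sum>j=1..m. f j * u (m - j))"
  shows "u \<longlonglongrightarrow> 1"
proof -
  have u_nonneg: "u m \<ge> 0" for m
  proof (induction m rule: less_induct)
    case (less m)
    have "(\<Sum>j=1..m. f j * u (m - j)) \<ge> 0"
      by (intro sum_nonneg mult_nonneg_nonneg nonneg less.IH) auto
    moreover have "real m * f m \<ge> 0" using nonneg by simp
    ultimately show ?case using rec[of m] by linarith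
  qed
  have rec': "u m = (\<Sum>j=1..N. f j * u (m - j))" if "m > N" for m
  proof -
    have "(\<Sum>j=1..m. f j * u (m - j)) = (\<Sum>j=1..N. f j * u (m - j))"
      using that supp by (intro sum.mono_neutral_right) auto
    then show ?thesis using rec[of m] supp[OF that] by simp
  qed
  obtain L where L: "u \<longlonglongrightarrow> L"
    using renewal_converges[OF nonneg f2 f3 total N u_nonneg rec'] by (auto simp: convergent_def)
  define F where "F k = (\<Sum>j=k+1..N. f j)" for k
  have F0: "F 0 = 1" using total by (simp add: F_def)
  have F_diff: "F k = f (Suc k) + F (Suc k)" for k
  proof (cases "Suc k \<le> N")
    case True
    then show ?thesis unfolding F_def Suc_eq_plus1[symmetric] by (rule sum.atLeast_Suc_atMost)
  next
    case False then show ?thesis using supp[of "Suc k"] by (simp add: F_def)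
  qed
  have F_supp: "F k = 0" if "k \<ge> N" for k using that by (simp add: F_def)
  define T where "T m = (\<Sum>k\<le>m. F k * u (m - k))" for m
  have T: "T m = (\<Sum>j\<le>m. real j * f j)" for m
  proof (induction m)
    case 0
    show ?case using rec[of 0] by (simp add: T_def)
  next
    case (Suc m)
    have "T (Suc m) = u (Suc m) + (\<Sum>k\<le>m. F (Suc k) * u (m - k))"
      unfolding T_def by (subst sum.atMost_Suc_shift) (simp add: F0)
    moreover have "T m = (\<Sum>k\<le>m. f (Suc k) * u (m - k)) + (\<Sum>k\<le>m. F (Suc k) * u (m - k))"
    proof -
      have "F k * u (m - k) = f (Suc k) * u (m - k) + F (Suc k) * u (m - k)" for k
        using F_diff[of k] by (simp add: distrib_right)
      then show ?thesis unfolding T_def by (simp add: sum.distrib)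
    qed
    moreover have "(\<Sum>j=1..Suc m. f j * u (Suc m - j)) = (\<Sum>k\<le>m. f (Suc k) * u (m - k))"
      by (rule sum.reindex_bij_witness[of _ Suc "\<lambda>j. j - 1"]) auto
    ultimately show ?case using rec[of "Suc m"] Suc.IH by simp
  qed
  define \<mu> where "\<mu> = (\<Sum>j\<le>N. real j * f j)"
  have "2 * f 2 \<le> \<mu>" unfolding \<mu>_def using N nonneg
    using member_le_sum[of 2 "{..N}" "\<lambda>j. real j * f j"] by auto
  with f2 have mu: "\<mu> > 0" by simp
  have Tmu: "T m = \<mu>" if "m \<ge> N" for m
    unfolding T \<mu>_def using that supp by (intro sum.mono_neutral_right) auto
  have T': "T m = (\<Sum>k<N. F k * u (m - k))" if "m \<ge> N" for m
    unfolding T_def using that F_supp by (intro sum.mono_neutral_right) auto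
  have sumF: "(\<Sum>k<M. F k) = (\<Sum>j\<le>M. real j * f j) + real M * F M" for M
  proof (induction M)
    case (Suc M)
    then show ?case using F_diff[of M] by (simp add: algebra_simps)
  qed simp
  have "(\<lambda>m. \<Sum>k<N. F k * u (m - k)) \<longlonglongrightarrow> (\<Sum>k<N. F k * L)"
  proof (intro tendsto_sum tendsto_mult tendsto_const)
    fix k
    show "(\<lambda>m. u (m - k)) \<longlonglongrightarrow> L"
      by (rule LIMSEQ_offset[where k=k]) (simp add: L)
  qed
  moreover have "eventually (\<lambda>m. (\<Sum>k<N. F k * u (m - k)) = \<mu>) sequentially"
    using T' Tmu by (auto simp: eventually_sequentially intro!: exI[of _ N])
  ultimately have "(\<lambda>m::nat. \<mu>) \<longlonglongrightarrow> (\<Sum>k<N. F k * L)"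
    by (rule Lim_transform_eventually)
  then have "(\<Sum>k<N. F k * L) = \<mu>"
    by (simp add: LIMSEQ_const_iff)
  moreover have "(\<Sum>k<N. F k * L) = \<mu> * L"
    using sumF[of N] F_supp[of N] by (simp add: \<mu>_def flip: sum_distrib_right)
  ultimately have "L = 1" using mu by simp
  with L show ?thesis by simp
qed

section \<open>Infinite products with integer exponents\<close>

text \<open>
The factors of the product formula in the order of their index, so that the factor with index \<open>j\<close>
affects only coefficients of degree at least \<open>j\<close>.
\<close>

definition deviation_factor :: "nat \<Rightarrow> int \<Rightarrow> real fps" where
  "deviation_factor j k = (if odd j then (1 + fps_X ^ j) powi k else 1 / (1 - fps_X ^ j) powi k)"

definition partial_product :: "(nat \<Rightarrow> int) \<Rightarrow> nat \<Rightarrow> real fps" where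
  "partial_product \<epsilon> N = (\<Prod>j=1..N. deviation_factor j (\<epsilon> j))"

text \<open>
For \<open>j > 0\<close>, \<open>F\<close> is congruent to \<open>1 + a X\<^sup>j\<close> modulo \<open>X\<^sup>j\<^sup>+\<^sup>1\<close>.  The series with this property form a group under
multiplication, on which \<open>a\<close> is additive; this computes the effect of integer exponents.
\<close>

definition unipotent_at :: "nat \<Rightarrow> real \<Rightarrow> real fps \<Rightarrow> bool" where
  "unipotent_at j a F \<longleftrightarrow> (\<forall>i\<le>j. F $ i = (if i = 0 then 1 else if i = j then a else 0))"

lemma unipotent_mult_nth:
  assumes F: "unipotent_at j a F" and j: "j > 0" and i: "i \<le> j"
  shows "(F * G) $ i = G $ i + (if i = j then a * G $ 0 else 0)"
proof -
  have "(F * G) $ i = (\<Sum>l=0..i. F $ l * G $ (i - l))" by (simp add: fps_mult_nth)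
  also have "\<dots> = (\<Sum>l\<in>{0,i}. F $ l * G $ (i - l))"
    using F i by (intro sum.mono_neutral_right) (auto simp: unipotent_at_def)
  also have "\<dots> = G $ i + (if i = j then a * G $ 0 else 0)"
    using F i j by (cases "i = 0") (auto simp: unipotent_at_def)
  finally show ?thesis .
qed

lemma unipotent_mult:
  "unipotent_at j a F \<Longrightarrow> unipotent_at j b G \<Longrightarrow> j > 0 \<Longrightarrow> unipotent_at j (a + b) (F * G)"
  by (subst unipotent_at_def) (auto simp: unipotent_mult_nth, auto simp: unipotent_at_def)

lemma unipotent_inverse:
  assumes F: "unipotent_at j a F" and j: "j > 0"
  shows "unipotent_at j (- a) (inverse F)"
proof -
  have F0: "F $ 0 = 1" using F by (simp add: unipotent_at_def)
  then have "F * inverse F = 1" by (simp add: inverse_mult_eq_1')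
  then have key: "inverse F $ i + (if i = j then a else 0) = (1 :: real fps) $ i" if "i \<le> j" for i
    using unipotent_mult_nth[OF F j that, of "inverse F"] F0 by simp
  show ?thesis unfolding unipotent_at_def
  proof (intro allI impI)
    fix i assume "i \<le> j"
    from key[OF this] show "inverse F $ i = (if i = 0 then 1 else if i = j then - a else 0)"
      using j F0 by (auto split: if_splits)
  qed
qed

lemma unipotent_power: "unipotent_at j a F \<Longrightarrow> j > 0 \<Longrightarrow> unipotent_at j (real n * a) (F ^ n)"
proof (induction n)
  case 0 then show ?case by (simp add: unipotent_at_def)
next
  case (Suc n)
  then show ?case using unipotent_mult[of j a F "real n * a" "F ^ n"] by (simp add: algebra_simps)
qed

lemma unipotent_power_int:
  assumes "unipotent_at j a F" "j > 0"
  shows "unipotent_at j (real_of_int k * a) (F powi k)"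
proof (cases "k \<ge> 0")
  case True then show ?thesis using unipotent_power[OF assms, of "nat k"] by (simp add: power_int_def)
next
  case False
  then show ?thesis
    using unipotent_power[OF unipotent_inverse[OF assms] assms(2), of "nat (- k)"] by (simp add: power_int_def)
qed

lemma power_int_nth_0: "F $ 0 = 1 \<Longrightarrow> (F powi k) $ 0 = 1" for F :: "real fps"
  by (simp add: power_int_def fps_power_zeroth)

lemma unipotent_deviation_factor:
  assumes j: "j > 0"
  shows "unipotent_at j (real_of_int k) (deviation_factor j k)"
proof -
  have "unipotent_at j 1 (1 + fps_X ^ j)" "unipotent_at j (-1) (1 - fps_X ^ j)"
    using j by (auto simp: unipotent_at_def fps_X_power_nth)
  from unipotent_power_int[OF this(1) j, of k] unipotent_inverse[OF unipotent_power_int[OF this(2) j, of k] j]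
  show ?thesis
    using j by (simp add: deviation_factor_def fps_divide_unit power_int_nth_0)
qed

definition integral_fps :: "real fps \<Rightarrow> bool" where
  "integral_fps F \<longleftrightarrow> (\<forall>i. F $ i \<in> \<int>)"

lemma integral_fps_mult: "integral_fps F \<Longrightarrow> integral_fps G \<Longrightarrow> integral_fps (F * G)"
  by (auto simp: integral_fps_def fps_mult_nth intro!: Ints_sum Ints_mult)

lemma integral_fps_power: "integral_fps F \<Longrightarrow> integral_fps (F ^ n)"
proof (induction n)
  case 0 then show ?case by (simp add: integral_fps_def)
qed (simp add: integral_fps_mult)

lemma integral_fps_inverse:
  assumes F: "integral_fps F" and F0: "F $ 0 = 1"
  shows "integral_fps (inverse F)"
  unfolding integral_fps_def
proof
  fix n
  show "inverse F $ n \<in> \<int>"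
  proof (induction n rule: less_induct)
    case (less n)
    show ?case
    proof (cases "n = 0")
      case False
      have "F * inverse F = 1" using F0 by (simp add: inverse_mult_eq_1')
      then have "0 = (F * inverse F) $ n" using False by simp
      also have "\<dots> = (\<Sum>l=0..n. F $ l * inverse F $ (n - l))" by (rule fps_mult_nth)
      also have "\<dots> = inverse F $ n + (\<Sum>l=1..n. F $ l * inverse F $ (n - l))"
        using F0 by (simp add: sum.atLeast_Suc_atMost)
      finally have "inverse F $ n = - (\<Sum>l=1..n. F $ l * inverse F $ (n - l))" by simp
      also have "\<dots> \<in> \<int>"
        using F less.IH by (intro Ints_minus Ints_sum Ints_mult) (auto simp: integral_fps_def)
      finally show ?thesis .
    qed (simp add: F0)
  qed
qed

text \<open>
Integrality keeps the recursive construction of the deviations within the integers.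
\<close>

lemma integral_deviation_factor:
  assumes j: "j > 0"
  shows "integral_fps (deviation_factor j k)"
proof -
  have a: "integral_fps (F powi k)" if "integral_fps F" "F $ 0 = 1" for F
    unfolding power_int_def using that by (auto intro!: integral_fps_power integral_fps_inverse)
  have "integral_fps (1 + fps_X ^ j)" "integral_fps (1 - fps_X ^ j)"
    by (auto simp: integral_fps_def fps_X_power_nth)
  then show ?thesis
    using j by (auto simp: deviation_factor_def fps_divide_unit power_int_nth_0 intro!: a integral_fps_inverse)
qed

lemma partial_product_0: "partial_product \<epsilon> 0 = 1"
  by (simp add: partial_product_def)

lemma partial_product_Suc:
  "partial_product \<epsilon> (Suc N) = deviation_factor (Suc N) (\<epsilon> (Suc N)) * partial_product \<epsilon> N"
  by (simp add: partial_product_def mult.commute)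

lemma partial_product_nth_0: "partial_product \<epsilon> N $ 0 = 1"
proof (induction N)
  case (Suc N)
  then show ?case using unipotent_deviation_factor[of "Suc N" "\<epsilon> (Suc N)"]
    by (simp add: partial_product_Suc unipotent_at_def)
qed (simp add: partial_product_0)

lemma partial_product_Suc_nth:
  assumes "i \<le> Suc N"
  shows "partial_product \<epsilon> (Suc N) $ i =
    partial_product \<epsilon> N $ i + (if i = Suc N then real_of_int (\<epsilon> (Suc N)) else 0)"
  using unipotent_mult_nth[OF unipotent_deviation_factor _ assms, of "\<epsilon> (Suc N)" "partial_product \<epsilon> N"]
  by (simp add: partial_product_Suc partial_product_nth_0)

lemma partial_product_nth_stable: "i \<le> M \<Longrightarrow> partial_product \<epsilon> M $ i = partial_product \<epsilon> i $ i"
  by (induction M rule: dec_induct) (auto simp: partial_product_Suc_nth)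

text \<open>
The factors after the \<open>i\<close>-th do not change the coefficient of degree \<open>i\<close>, so the \<open>X\<close>-adic limit
can be read off from the diagonal.
\<close>

lemma has_deviations_iff: "has_deviations P \<epsilon> \<longleftrightarrow> (\<forall>i. partial_product \<epsilon> i $ i = P $ i)"
proof -
  have "(\<Prod>i=1..N. (1 + fps_X ^ (2 * i - 1)) powi \<epsilon> (2 * i - 1) / (1 - fps_X ^ (2 * i)) powi \<epsilon> (2 * i))
      = partial_product \<epsilon> (2 * N)" for N
  proof (induction N)
    case (Suc N)
    have "deviation_factor (Suc (2 * N)) k * deviation_factor (2 * Suc N) l =
        (1 + fps_X ^ (2 * Suc N - 1)) powi k / (1 - fps_X ^ (2 * Suc N)) powi l" for k l
    proof -
      have "((1 - fps_X ^ (2 * Suc N)) powi l :: real fps) $ 0 = 1"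
        by (simp add: power_int_nth_0)
      then show ?thesis by (simp add: deviation_factor_def fps_divide_unit)
    qed
    with Suc show ?case by (simp add: partial_product_Suc mult_ac)
  qed (simp add: partial_product_0)
  then have "has_deviations P \<epsilon> \<longleftrightarrow> (\<lambda>N. partial_product \<epsilon> (2 * N)) \<longlonglongrightarrow> P"
    by (simp add: has_deviations_def)
  also have "\<dots> \<longleftrightarrow> (\<forall>i. eventually (\<lambda>N. partial_product \<epsilon> (2 * N) $ i = P $ i) sequentially)"
    by (rule tendsto_fps_iff)
  also have "\<dots> \<longleftrightarrow> (\<forall>i. partial_product \<epsilon> i $ i = P $ i)"
  proof (intro all_cong1)
    fix i
    have stable: "eventually (\<lambda>N. partial_product \<epsilon> (2 * N) $ i = partial_product \<epsilon> i $ i) sequentially"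
      by (rule eventually_sequentiallyI[of i], rule partial_product_nth_stable) simp
    show "eventually (\<lambda>N. partial_product \<epsilon> (2 * N) $ i = P $ i) sequentially \<longleftrightarrow>
      partial_product \<epsilon> i $ i = P $ i"
    proof
      assume "eventually (\<lambda>N. partial_product \<epsilon> (2 * N) $ i = P $ i) sequentially"
      with stable have "eventually (\<lambda>N::nat. partial_product \<epsilon> i $ i = P $ i) sequentially"
        by eventually_elim simp
      then show "partial_product \<epsilon> i $ i = P $ i" by simp
    next
      assume "partial_product \<epsilon> i $ i = P $ i"
      with stable show "eventually (\<lambda>N. partial_product \<epsilon> (2 * N) $ i = P $ i) sequentially"
        by simp
    qed
  qed
  finally show ?thesis .
qed

text \<open>
The coefficient of degree \<open>n\<close> of the \<open>n\<close>-th partial product is \<open>\<epsilon> n\<close> plus a term that depends only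
on the earlier exponents.
\<close>

lemma deviations_unique:
  assumes "has_deviations P \<epsilon>" "has_deviations P \<epsilon>'" "\<epsilon> 0 = \<epsilon>' 0"
  shows "\<epsilon> = \<epsilon>'"
proof
  fix n
  show "\<epsilon> n = \<epsilon>' n"
  proof (induction n rule: less_induct)
    case (less n)
    show ?case
    proof (cases n)
      case (Suc m)
      have "partial_product \<epsilon> m = partial_product \<epsilon>' m"
        unfolding partial_product_def using less Suc by (intro prod.cong) auto
      moreover have "partial_product \<epsilon> n $ n = partial_product \<epsilon>' n $ n"
        using assms by (simp add: has_deviations_iff)
      ultimately show ?thesis using Suc by (simp add: partial_product_Suc_nth)
    qed (use assms in simp)
  qed
qed

text \<open>
Each exponent is the error of the previous partial product in the next degree.  The floor only serves
to turn this real number, which is an integer, into an element of type \<open>int\<close>.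
\<close>

lemma deviations_exist:
  assumes P: "integral_fps P" and P0: "P $ 0 = 1"
  shows "\<exists>\<epsilon>. \<epsilon> 0 = 0 \<and> has_deviations P \<epsilon>"
proof -
  define G where "G = rec_nat 1
    (\<lambda>N F. deviation_factor (Suc N) \<lfloor>P $ Suc N - F $ Suc N\<rfloor> * F)"
  have G_0: "G 0 = 1" and
    G_Suc: "G (Suc N) = deviation_factor (Suc N) \<lfloor>P $ Suc N - G N $ Suc N\<rfloor> * G N" for N
    by (simp_all add: G_def)
  define \<epsilon> where "\<epsilon> n = (case n of 0 \<Rightarrow> 0 | Suc N \<Rightarrow> \<lfloor>P $ Suc N - G N $ Suc N\<rfloor>)" for n
  have G: "partial_product \<epsilon> N = G N" for N
    by (induction N) (simp_all add: partial_product_0 partial_product_Suc G_0 G_Suc \<epsilon>_def)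
  have int: "integral_fps (G N)" for N
  proof (induction N)
    case 0 then show ?case by (simp add: G_0 integral_fps_def)
  next
    case (Suc N) then show ?case
      unfolding G_Suc by (intro integral_fps_mult integral_deviation_factor) auto
  qed
  have "partial_product \<epsilon> i $ i = P $ i" for i
  proof (cases i)
    case 0 then show ?thesis by (simp add: partial_product_0 P0)
  next
    case (Suc N)
    have "P $ Suc N - G N $ Suc N \<in> \<int>"
      using P int[of N] by (auto simp: integral_fps_def)
    then have "real_of_int (\<epsilon> (Suc N)) = P $ Suc N - partial_product \<epsilon> N $ Suc N"
      unfolding G by (simp add: \<epsilon>_def of_int_floor)
    then show ?thesis using Suc by (simp add: partial_product_Suc_nth)
  qed
  then show ?thesis by (intro exI[of _ \<epsilon>]) (simp add: has_deviations_iff \<epsilon>_def)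
qed

text \<open>
The operator \<open>z d/dz log\<close>, which turns products into sums.
\<close>

definition log_deriv :: "real fps \<Rightarrow> real fps" where
  "log_deriv F = fps_X * fps_deriv F * inverse F"

lemma log_deriv_times: "F $ 0 \<noteq> 0 \<Longrightarrow> log_deriv F * F = fps_X * fps_deriv F"
  by (simp add: log_deriv_def mult.assoc inverse_mult_eq_1)

lemma log_deriv_mult:
  assumes "F $ 0 \<noteq> 0" "G $ 0 \<noteq> 0"
  shows "log_deriv (F * G) = log_deriv F + log_deriv G"
proof -
  have "F * inverse F = 1" "G * inverse G = 1"
    using assms by (simp_all add: inverse_mult_eq_1')
  moreover have "fps_X * (F * fps_deriv G + fps_deriv F * G) * (inverse F * inverse G) =
      fps_X * fps_deriv F * inverse F * (G * inverse G) + fps_X * fps_deriv G * inverse G * (F * inverse F)"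
    by (simp add: algebra_simps)
  ultimately show ?thesis by (simp add: log_deriv_def fps_inverse_mult)
qed

lemma log_deriv_1: "log_deriv 1 = 0" by (simp add: log_deriv_def)

lemma log_deriv_inverse:
  assumes "F $ 0 \<noteq> 0"
  shows "log_deriv (inverse F) = - log_deriv F"
proof -
  have "log_deriv (F * inverse F) = log_deriv F + log_deriv (inverse F)"
    using assms by (intro log_deriv_mult) auto
  moreover have "F * inverse F = 1" using assms by (simp add: inverse_mult_eq_1')
  ultimately show ?thesis by (simp add: log_deriv_1 eq_neg_iff_add_eq_0 add.commute)
qed

lemma log_deriv_power:
  assumes "F $ 0 \<noteq> 0" shows "log_deriv (F ^ n) = of_nat n * log_deriv F"
proof (induction n)
  case (Suc n)
  have "log_deriv (F * F ^ n) = log_deriv F + log_deriv (F ^ n)"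
    using assms by (intro log_deriv_mult) (auto simp: fps_power_zeroth)
  with Suc show ?case by (simp add: algebra_simps)
qed (simp add: log_deriv_1)

lemma log_deriv_power_int:
  assumes "F $ 0 \<noteq> 0" shows "log_deriv (F powi k) = of_int k * log_deriv F"
proof (cases "k \<ge> 0")
  case True
  then have "of_nat (nat k) = (of_int k :: real fps)" by (metis of_int_of_nat_eq int_nat_eq)
  with True show ?thesis using log_deriv_power[OF assms, of "nat k"] by (simp add: power_int_def)
next
  case False
  then have "of_nat (nat (- k)) = (- of_int k :: real fps)"
    by (metis of_int_of_nat_eq int_nat_eq of_int_minus neg_0_le_iff_le linear)
  with False show ?thesis
    using log_deriv_power[of "inverse F" "nat (- k)"] assms by (simp add: power_int_def log_deriv_inverse)
qed

text \<open>
The identity \<open>log_deriv F * F = X * fps_deriv F\<close> determines the coefficients of \<open>log_deriv F\<close> one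
after the other from those of \<open>F\<close>.
\<close>

lemma log_deriv_nth_cong:
  assumes eq: "\<And>i. i \<le> m \<Longrightarrow> F $ i = G $ i" and F0: "F $ 0 = 1"
  shows "log_deriv F $ m = log_deriv G $ m"
  using eq
proof (induction m rule: less_induct)
  case (less m)
  have G0: "G $ 0 = 1" using F0 less.prems[of 0] by simp
  have rec: "log_deriv H $ m = real m * H $ m - (\<Sum>i<m. log_deriv H $ i * H $ (m - i))"
    if "H $ 0 = 1" for H
  proof -
    have "(log_deriv H * H) $ m = real m * H $ m"
      using that by (cases m) (simp_all add: log_deriv_times)
    moreover have "(log_deriv H * H) $ m = log_deriv H $ m + (\<Sum>i<m. log_deriv H $ i * H $ (m - i))"
      using that by (simp add: fps_mult_nth atLeast0AtMost sum.lessThan_Suc flip: lessThan_Suc_atMost)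
    ultimately show ?thesis by simp
  qed
  have "(\<Sum>i<m. log_deriv F $ i * F $ (m - i)) = (\<Sum>i<m. log_deriv G $ i * G $ (m - i))"
    using less by (intro sum.cong) auto
  then show ?case using rec[OF F0] rec[OF G0] less.prems[of m] by simp
qed

definition factor_log_deriv :: "nat \<Rightarrow> real fps" where
  "factor_log_deriv j = (if odd j then log_deriv (1 + fps_X ^ j) else - log_deriv (1 - fps_X ^ j))"

lemma log_deriv_deviation_factor:
  assumes "j > 0"
  shows "log_deriv (deviation_factor j k) = of_int k * factor_log_deriv j"
proof -
  have "((1 - fps_X ^ j) powi k :: real fps) $ 0 = 1"
    using assms by (simp add: power_int_nth_0)
  then show ?thesis using assms
    by (simp add: deviation_factor_def factor_log_deriv_def log_deriv_power_int fps_divide_unit log_deriv_inverse)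
qed

text \<open>
The series is \<open>j X\<^sup>j / (1 + c X\<^sup>j)\<close>, and clearing the denominator gives a recursion with step \<open>j\<close>.
\<close>

lemma factor_log_deriv_nth:
  assumes j: "j > 0"
  defines "c \<equiv> (if odd j then 1 else - 1 :: real)"
  shows "factor_log_deriv j $ m = (if m = j then real j else 0) - (if m < j then 0 else c * factor_log_deriv j $ (m - j))"
proof -
  have D: "fps_X * fps_deriv (fps_X ^ j :: real fps) = fps_const (real j) * fps_X ^ j"
  proof (rule fps_ext)
    fix m show "(fps_X * fps_deriv (fps_X ^ j :: real fps)) $ m = (fps_const (real j) * fps_X ^ j) $ m"
      using j by (cases m) (auto simp: fps_X_power_nth)
  qed
  have "factor_log_deriv j * (1 + fps_const c * fps_X ^ j) = fps_const (real j) * fps_X ^ j"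
  proof (cases "odd j")
    case True
    then show ?thesis using j D by (simp add: factor_log_deriv_def c_def log_deriv_times)
  next
    case False
    then have "factor_log_deriv j * (1 + fps_const c * fps_X ^ j) = - (log_deriv (1 - fps_X ^ j) * (1 - fps_X ^ j))"
      by (simp add: factor_log_deriv_def c_def fps_const_neg[symmetric] del: fps_const_neg)
    then show ?thesis using j D by (simp add: log_deriv_times)
  qed
  then have "(factor_log_deriv j + fps_X ^ j * (fps_const c * factor_log_deriv j)) $ m = (fps_const (real j) * fps_X ^ j) $ m"
    by (simp add: algebra_simps)
  then show ?thesis by (simp add: fps_X_power_mult_nth fps_X_power_nth split: if_splits)
qed

lemma factor_log_deriv_bounds:
  assumes j: "j > 0"
  shows "factor_log_deriv j $ j = real j" "\<bar>factor_log_deriv j $ m\<bar> \<le> real j"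
    "\<not> (j dvd m \<and> m > 0) \<Longrightarrow> factor_log_deriv j $ m = 0"
proof -
  have 0: "factor_log_deriv j $ 0 = 0" using factor_log_deriv_nth[OF j, of 0] j by simp
  show 1: "factor_log_deriv j $ j = real j" using factor_log_deriv_nth[OF j, of j] 0 by simp
  have "\<bar>factor_log_deriv j $ m\<bar> \<le> real j \<and> (\<not> (j dvd m \<and> m > 0) \<longrightarrow> factor_log_deriv j $ m = 0)"
  proof (induction m rule: less_induct)
    case (less m)
    consider "m < j" | "m = j" | "m > j" by linarith
    then show ?case
    proof cases
      case 1 then show ?thesis using factor_log_deriv_nth[OF j, of m] by simp
    next
      case 2 then show ?thesis using \<open>factor_log_deriv j $ j = real j\<close> j by simp
    next
      case 3
      then have "\<bar>factor_log_deriv j $ m\<bar> = \<bar>factor_log_deriv j $ (m - j)\<bar>"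
        using factor_log_deriv_nth[OF j, of m] by (auto simp: abs_mult)
      moreover have "j dvd m - j \<longleftrightarrow> j dvd m" using 3 by (simp add: dvd_minus_self)
      ultimately show ?thesis using less[of "m - j"] 3 j by auto
    qed
  qed
  then show "\<bar>factor_log_deriv j $ m\<bar> \<le> real j"
    "\<not> (j dvd m \<and> m > 0) \<Longrightarrow> factor_log_deriv j $ m = 0" by auto
qed

lemma log_deriv_partial_product:
  "log_deriv (partial_product \<epsilon> N) = (\<Sum>j=1..N. of_int (\<epsilon> j) * factor_log_deriv j)"
proof (induction N)
  case (Suc N)
  have "deviation_factor (Suc N) (\<epsilon> (Suc N)) $ 0 = 1"
    using unipotent_deviation_factor[of "Suc N"] by (simp add: unipotent_at_def)
  then show ?case
    by (simp add: partial_product_Suc log_deriv_mult partial_product_nth_0 log_deriv_deviation_factor Suc)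
qed (simp add: partial_product_0 log_deriv_1)

text \<open>
In degree \<open>m\<close> only the factors whose index divides \<open>m\<close> contribute to the logarithmic derivative of the
product.  The index \<open>m\<close> contributes \<open>m * \<epsilon> m\<close>, and all other divisors are at most \<open>m / 2\<close>.
\<close>

lemma deviation_near_log_deriv:
  assumes dev: "has_deviations P \<epsilon>" and m: "m > 0"
  shows "\<bar>real m * real_of_int (\<epsilon> m) - log_deriv P $ m\<bar> \<le> (\<Sum>j=1..m div 2. \<bar>real j * real_of_int (\<epsilon> j)\<bar>)"
proof -
  have "log_deriv P $ m = log_deriv (partial_product \<epsilon> m) $ m"
  proof (rule log_deriv_nth_cong[symmetric])
    fix i assume "i \<le> m"
    then show "partial_product \<epsilon> m $ i = P $ i"
      using dev partial_product_nth_stable[of i m \<epsilon>] by (simp add: has_deviations_iff)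
  qed (rule partial_product_nth_0)
  also have "\<dots> = (\<Sum>j=1..m. real_of_int (\<epsilon> j) * factor_log_deriv j $ m)"
    by (simp add: log_deriv_partial_product fps_sum_nth flip: fps_of_int)
  also have "\<dots> = real m * real_of_int (\<epsilon> m) + (\<Sum>j=1..<m. real_of_int (\<epsilon> j) * factor_log_deriv j $ m)"
    using m factor_log_deriv_bounds(1)[OF m] by (cases m) (simp_all add: atLeastLessThanSuc_atLeastAtMost)
  also have "(\<Sum>j=1..<m. real_of_int (\<epsilon> j) * factor_log_deriv j $ m)
      = (\<Sum>j=1..m div 2. real_of_int (\<epsilon> j) * factor_log_deriv j $ m)"
  proof (rule sum.mono_neutral_right)
    show "\<forall>j\<in>{1..<m} - {1..m div 2}. real_of_int (\<epsilon> j) * factor_log_deriv j $ m = 0"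
    proof
      fix j assume j: "j \<in> {1..<m} - {1..m div 2}"
      have "\<not> j dvd m"
      proof
        assume "j dvd m"
        then obtain q where q: "m = j * q" by auto
        have "q \<noteq> 0" "q \<noteq> 1" using q j by auto
        then have "2 \<le> q" by simp
        then have "j * 2 \<le> m" using q by simp
        then show False using j by auto
      qed
      then show "real_of_int (\<epsilon> j) * factor_log_deriv j $ m = 0"
        using factor_log_deriv_bounds(3)[of j m] j by simp
    qed
  qed (use m in auto)
  finally have "\<bar>real m * real_of_int (\<epsilon> m) - log_deriv P $ m\<bar>
      = \<bar>\<Sum>j=1..m div 2. real_of_int (\<epsilon> j) * factor_log_deriv j $ m\<bar>" by simp
  also have "\<dots> \<le> (\<Sum>j=1..m div 2. \<bar>real_of_int (\<epsilon> j) * factor_log_deriv j $ m\<bar>)" by (rule sum_abs)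
  also have "\<dots> \<le> (\<Sum>j=1..m div 2. \<bar>real j * real_of_int (\<epsilon> j)\<bar>)"
  proof (rule sum_mono)
    fix j assume "j \<in> {1..m div 2}"
    then have "\<bar>factor_log_deriv j $ m\<bar> \<le> real j" using factor_log_deriv_bounds(2)[of j m] by simp
    then have "\<bar>real_of_int (\<epsilon> j)\<bar> * \<bar>factor_log_deriv j $ m\<bar> \<le> \<bar>real_of_int (\<epsilon> j)\<bar> * real j"
      by (rule mult_left_mono) simp
    then show "\<bar>real_of_int (\<epsilon> j) * factor_log_deriv j $ m\<bar> \<le> \<bar>real j * real_of_int (\<epsilon> j)\<bar>"
      by (simp add: abs_mult mult.commute)
  qed
  finally show ?thesis .
qed

section \<open>Deviations of a series of Golod type\<close>

text \<open>
First \<open>a m = O(\<rho>\<^sup>m)\<close> by induction: the sum up to \<open>m / 2\<close> is of order \<open>m s\<^sup>m\<close> with \<open>s\<^sup>2 = \<rho>\<close>, which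
is small compared with \<open>\<rho>\<^sup>m\<close>.  With this bound known, the same estimate shows that the perturbation is
negligible.
\<close>

lemma asymptotics_of_self_bounded_perturbation:
  fixes a d :: "nat \<Rightarrow> real"
  assumes \<rho>: "\<rho> > 1" and d: "(\<lambda>m. d m / \<rho> ^ m) \<longlonglongrightarrow> l"
    and a: "\<And>m. m > 0 \<Longrightarrow> \<bar>a m - d m\<bar> \<le> (\<Sum>j=1..m div 2. \<bar>a j\<bar>)"
  shows "(\<lambda>m. a m / \<rho> ^ m) \<longlonglongrightarrow> l"
proof -
  define s where "s = sqrt \<rho>"
  have s: "s > 1" "s * s = \<rho>" using \<rho> by (auto simp: s_def)
  have sm: "\<rho> ^ m = s ^ m * s ^ m" for m by (simp flip: s(2) add: power_mult_distrib)
  have half: "\<rho> ^ (m div 2) \<le> s ^ m" for m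
  proof -
    have "\<rho> ^ (m div 2) = s ^ (2 * (m div 2))" by (simp add: power_mult power2_eq_square s)
    also have "\<dots> \<le> s ^ m" using s by (intro power_increasing) auto
    finally show ?thesis .
  qed
  have small: "(\<lambda>m. real m / s ^ m) \<longlonglongrightarrow> 0"
    using powser_times_n_limit_0[of "1 / s"] s by (simp add: power_divide)
  obtain K where K: "\<And>m. \<bar>d m / \<rho> ^ m\<bar> \<le> K"
    using convergent_imp_Bseq[of "\<lambda>m. d m / \<rho> ^ m"] d by (auto simp: Bseq_def convergent_def)
  have dK: "\<bar>d m\<bar> \<le> K * \<rho> ^ m" for m
    using K[of m] \<rho> by (simp add: abs_divide divide_le_eq)
  have K0: "K \<ge> 0" using K[of 0] by linarith
  obtain m0 where m0: "\<And>m. m \<ge> m0 \<Longrightarrow> real m / s ^ m < 1 / 2"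
    using order_tendstoD(2)[OF small, of "1/2"] by (auto simp: eventually_sequentially)
  have half_sum: "(\<Sum>j=1..m div 2. \<bar>a j\<bar>) \<le> C * (real m * s ^ m)"
    if C: "C \<ge> 0" and bd: "\<And>j. 0 < j \<Longrightarrow> j < m \<Longrightarrow> \<bar>a j\<bar> \<le> C * \<rho> ^ j" for m C
  proof -
    have "(\<Sum>j=1..m div 2. \<bar>a j\<bar>) \<le> (\<Sum>j=1..m div 2. C * s ^ m)"
    proof (rule sum_mono)
      fix j assume j: "j \<in> {1..m div 2}"
      then have "\<bar>a j\<bar> \<le> C * \<rho> ^ j" by (intro bd) auto
      also have "\<dots> \<le> C * \<rho> ^ (m div 2)"
        using j \<rho> C by (intro mult_left_mono power_increasing) auto
      also have "\<dots> \<le> C * s ^ m" using half C by (intro mult_left_mono)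
      finally show "\<bar>a j\<bar> \<le> C * s ^ m" .
    qed
    also have "\<dots> = C * (real (m div 2) * s ^ m)" by simp
    also have "\<dots> \<le> C * (real m * s ^ m)" 
      using C s by (intro mult_left_mono mult_right_mono) auto
    finally show ?thesis .
  qed
  \<comment> \<open>The sum covers the indices up to \<open>m0\<close>; beyond it, \<open>K \<le> C / 2\<close> leaves room for the perturbation.\<close>
  define C where "C = 2 * K + (\<Sum>j\<le>m0. \<bar>a j\<bar>)"
  have C0: "C \<ge> 0" "K \<le> C / 2" using K0 by (auto simp: C_def intro: add_nonneg_nonneg sum_nonneg)
  have bound: "\<bar>a m\<bar> \<le> C * \<rho> ^ m" if "m > 0" for m
    using that
  proof (induction m rule: less_induct)
    case (less m)
    show ?case
    proof (cases "m \<le> m0")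
      case True
      have "\<bar>a m\<bar> \<le> (\<Sum>j\<le>m0. \<bar>a j\<bar>)" using True by (intro member_le_sum) auto
      then have "\<bar>a m\<bar> \<le> C" using K0 by (simp add: C_def)
      also have "\<dots> \<le> C * \<rho> ^ m" using C0 \<rho> by (simp add: mult_le_cancel_left1)
      finally show ?thesis .
    next
      case False
      have "\<bar>a m\<bar> \<le> \<bar>d m\<bar> + (\<Sum>j=1..m div 2. \<bar>a j\<bar>)" using a[OF less.prems] by linarith
      also have "\<dots> \<le> K * \<rho> ^ m + C * (real m * s ^ m)"
        using less by (intro add_mono dK half_sum C0) auto
      also have "\<dots> \<le> C / 2 * \<rho> ^ m + C * (1 / 2 * \<rho> ^ m)"
      proof (rule add_mono)
        show "K * \<rho> ^ m \<le> C / 2 * \<rho> ^ m" using C0 \<rho> by (intro mult_right_mono) auto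
        have "real m \<le> 1 / 2 * s ^ m" using m0[of m] False s by (simp add: field_simps)
        then have "real m * s ^ m \<le> 1 / 2 * s ^ m * s ^ m" using s by (intro mult_right_mono) auto
        then have "real m * s ^ m \<le> 1 / 2 * \<rho> ^ m" by (simp add: sm)
        then show "C * (real m * s ^ m) \<le> C * (1 / 2 * \<rho> ^ m)" using C0 by (intro mult_left_mono)
      qed
      finally show ?thesis by simp
    qed
  qed
  have "(\<lambda>m. a m / \<rho> ^ m - d m / \<rho> ^ m) \<longlonglongrightarrow> 0"
  proof (rule tendsto_0_le[where K = 1])
    show "(\<lambda>m. C * (real m / s ^ m)) \<longlonglongrightarrow> 0" using tendsto_mult_right_zero[OF small] by simp
    show "eventually (\<lambda>m. norm (a m / \<rho> ^ m - d m / \<rho> ^ m) \<le> norm (C * (real m / s ^ m)) * 1) sequentially"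
    proof (rule eventually_sequentiallyI[of 1])
      fix m :: nat assume m: "1 \<le> m"
      have "\<bar>a m - d m\<bar> \<le> C * (real m * s ^ m)"
        using a[of m] half_sum[of C m] C0 bound m by force
      then have "\<bar>a m - d m\<bar> / \<rho> ^ m \<le> C * (real m * s ^ m) / \<rho> ^ m"
        using \<rho> by (intro divide_right_mono) auto
      also have "\<dots> = C * (real m / s ^ m)" using s by (simp add: sm)
      finally show "norm (a m / \<rho> ^ m - d m / \<rho> ^ m) \<le> norm (C * (real m / s ^ m)) * 1"
        using \<rho> s C0 by (simp add: abs_divide flip: diff_divide_distrib)
    qed
  qed
  from tendsto_add[OF this d] show ?thesis by simp
qed

text \<open>
The sum vanishes at 0 and is at least 2 at 1, so it takes the value 1 in between.
\<close>

lemma golod_denominator_root: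
  fixes c :: "nat \<Rightarrow> real"
  assumes c: "\<And>j. c j \<ge> 0" and c23: "c 2 \<ge> 1" "c 3 \<ge> 1" and N: "N \<ge> 3"
  shows "\<exists>r. 0 < r \<and> r < 1 \<and> (\<Sum>j=1..N. c j * r ^ j) = 1"
proof -
  let ?g = "\<lambda>r. \<Sum>j=1..N. c j * r ^ j"
  have "?g 0 = 0" by (intro sum.neutral) auto
  have "c 2 + c 3 = sum c {2,3}" by simp
  also have "\<dots> \<le> sum c {1..N}" using c N by (intro sum_mono2) auto
  finally have g1: "?g 1 \<ge> 2" using c23 by simp
  have "\<exists>r. 0 \<le> r \<and> r \<le> 1 \<and> ?g r = 1"
    using \<open>?g 0 = 0\<close> g1 by (intro IVT') (auto intro!: continuous_intros)
  then obtain r where r: "0 \<le> r" "r \<le> 1" "?g r = 1" by auto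
  moreover have "r \<noteq> 0" using r \<open>?g 0 = 0\<close> by auto
  moreover have "r \<noteq> 1" using r g1 by auto
  ultimately show ?thesis by (intro exI[of _ r]) auto
qed

text \<open>
With the numerator contributing only a bounded amount, the logarithmic derivative is governed by the
coefficients \<open>p\<close> of \<open>- z D'/D\<close>, to which the renewal theorem applies after scaling by the root \<open>r\<close>.
\<close>

lemma golod_series_deviations:
  fixes b :: "nat \<Rightarrow> nat"
  assumes n: "n \<ge> 2" and b: "b 1 > 0" "b 2 > 0"
    and P: "P = (1 + fps_X) ^ n / (1 - (\<Sum>i=1..n. fps_const (real (b i)) * fps_X ^ (i + 1)))"
    and dev: "has_deviations P \<epsilon>"
  shows "\<exists>\<rho>::real. \<rho> > 1 \<and> (\<lambda>i. real_of_int (\<epsilon> i) / (\<rho> ^ i / real i)) \<longlonglongrightarrow> 1"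
proof -
  define c where "c j = (if 2 \<le> j \<and> j \<le> n + 1 then real (b (j - 1)) else 0)" for j
  define D where "D = 1 - (\<Sum>i=1..n. fps_const (real (b i)) * fps_X ^ (i + 1))"
  have D_nth: "D $ j = (if j = 0 then 1 else - c j)" for j
  proof -
    have "(\<Sum>i=1..n. fps_const (real (b i)) * fps_X ^ (i + 1)) $ j = (\<Sum>i=1..n. if j = i + 1 then real (b i) else 0)"
      unfolding fps_sum_nth fps_mult_left_const_nth fps_X_power_nth by (intro sum.cong) auto
    also have "\<dots> = (\<Sum>i=1..n. if i = j - 1 then c j else 0)"
      by (intro sum.cong) (auto simp: c_def)
    also have "\<dots> = c j" by (auto simp: c_def)
    finally show ?thesis by (auto simp: D_def c_def)
  qed
  have c_nonneg: "c j \<ge> 0" for j by (simp add: c_def)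
  obtain r where r: "0 < r" "r < 1" and root: "(\<Sum>j=1..n+1. c j * r ^ j) = 1"
    using golod_denominator_root[of c "n + 1"] c_nonneg n b by (auto simp: c_def)
  define p where "p = - log_deriv D"
  have p: "p $ m = real m * c m + (\<Sum>j=1..m. c j * p $ (m - j))" for m
  proof -
    have "p * D = - (fps_X * fps_deriv D)" using D_nth[of 0] by (simp add: p_def log_deriv_times)
    then have "(p * D) $ m = - (fps_X * fps_deriv D) $ m" by simp
    also have "\<dots> = real m * c m" by (cases m) (simp_all add: D_nth)
    finally have "real m * c m = (D * p) $ m" by (simp add: mult.commute)
    also have "\<dots> = p $ m + (\<Sum>j=1..m. D $ j * p $ (m - j))"
      by (simp add: fps_mult_nth sum.atLeast_Suc_atMost D_nth)
    also have "(\<Sum>j=1..m. D $ j * p $ (m - j)) = - (\<Sum>j=1..m. c j * p $ (m - j))"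
      unfolding sum_negf[symmetric] by (intro sum.cong) (auto simp: D_nth)
    finally show ?thesis by simp
  qed
  have lim_p: "(\<lambda>m. p $ m * r ^ m) \<longlonglongrightarrow> 1"
  proof (rule renewal_limit[where f = "\<lambda>j. c j * r ^ j" and N = "n + 1"])
    fix m
    have "p $ m * r ^ m = real m * (c m * r ^ m) + (\<Sum>j=1..m. c j * p $ (m - j) * r ^ m)"
      by (subst p) (simp add: algebra_simps sum_distrib_left)
    also have "(\<Sum>j=1..m. c j * p $ (m - j) * r ^ m) = (\<Sum>j=1..m. c j * r ^ j * (p $ (m - j) * r ^ (m - j)))"
    proof (rule sum.cong[OF refl])
      fix j assume "j \<in> {1..m}"
      then have "r ^ m = r ^ j * r ^ (m - j)" by (simp flip: power_add)
      then show "c j * p $ (m - j) * r ^ m = c j * r ^ j * (p $ (m - j) * r ^ (m - j))" by simp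
    qed
    finally show "p $ m * r ^ m = real m * (c m * r ^ m) + (\<Sum>j=1..m. c j * r ^ j * (p $ (m - j) * r ^ (m - j)))" .
  qed (use r root n b c_nonneg in \<open>auto simp: c_def\<close>)
  define \<rho> where "\<rho> = 1 / r"
  have \<rho>: "\<rho> > 1" using r by (simp add: \<rho>_def)
  have over_\<rho>: "x / \<rho> ^ m = x * r ^ m" for x m by (simp add: \<rho>_def power_divide)
  have "log_deriv P = of_nat n * factor_log_deriv 1 + p"
  proof -
    have D0: "D $ 0 = 1" by (simp add: D_nth)
    then have "P = (1 + fps_X) ^ n * inverse D" unfolding P D_def[symmetric] by (intro fps_divide_unit) simp
    then have "log_deriv P = log_deriv ((1 + fps_X) ^ n) + log_deriv (inverse D)"
      using D0 by (simp add: log_deriv_mult fps_power_zeroth)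
    then show ?thesis
      using D0 by (simp add: log_deriv_inverse log_deriv_power p_def factor_log_deriv_def)
  qed
  then have P_nth: "log_deriv P $ m = real n * factor_log_deriv 1 $ m + p $ m" for m
    by (simp flip: fps_of_nat)
  have "(\<lambda>m. real n * factor_log_deriv 1 $ m * r ^ m) \<longlonglongrightarrow> 0"
  proof (rule tendsto_0_le[where K = 1])
    show "(\<lambda>m. real n * r ^ m) \<longlonglongrightarrow> 0"
      using tendsto_mult_right_zero[OF LIMSEQ_power_zero[of r]] r by simp
    show "eventually (\<lambda>m. norm (real n * factor_log_deriv 1 $ m * r ^ m) \<le> norm (real n * r ^ m) * 1) sequentially"
    proof (intro always_eventually allI)
      fix m
      have "\<bar>factor_log_deriv 1 $ m\<bar> * (real n * r ^ m) \<le> 1 * (real n * r ^ m)"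
        using factor_log_deriv_bounds(2)[of 1 m] r by (intro mult_right_mono) auto
      then show "norm (real n * factor_log_deriv 1 $ m * r ^ m) \<le> norm (real n * r ^ m) * 1"
        using r by (simp add: abs_mult mult_ac)
    qed
  qed
  from tendsto_add[OF this lim_p] have "(\<lambda>m. log_deriv P $ m / \<rho> ^ m) \<longlonglongrightarrow> 1"
    by (simp add: over_\<rho> P_nth algebra_simps)
  then have "(\<lambda>m. real m * real_of_int (\<epsilon> m) / \<rho> ^ m) \<longlonglongrightarrow> 1"
    by (rule asymptotics_of_self_bounded_perturbation[OF \<rho>]) (rule deviation_near_log_deriv[OF dev])
  then have "(\<lambda>i. real_of_int (\<epsilon> i) / (\<rho> ^ i / real i)) \<longlonglongrightarrow> 1"
    by (simp add: mult.commute)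
  with \<rho> show ?thesis by blast
qed

text \<open>
The deviations exist because the coefficients of the Poincare series are integers and its constant
term, computed from Golod's formula, is 1.
\<close>

lemma golod_deviation_asymptotics:
  fixes I :: "('n::finite, 'k::field) mpoly set"
  assumes golod: "golod I" and n: "CARD('n) \<ge> 2"
    and b: "betti_over_poly I 1 > 0" "betti_over_poly I 2 > 0"
  shows "\<exists>\<rho>::real. \<rho> > 1 \<and> (\<lambda>i. real_of_int (deviation I i) / (\<rho> ^ i / real i)) \<longlonglongrightarrow> 1"
proof -
  let ?D = "1 - (\<Sum>i=1..CARD('n). fps_const (real (betti_over_poly I i)) * fps_X ^ (i + 1))"
  have P: "poincare_series I = (1 + fps_X) ^ CARD('n) / ?D" using golod by (simp add: golod_def)
  have "?D $ 0 = 1" by (simp add: fps_sum_nth)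
  then have "poincare_series I $ 0 = 1" by (simp add: P fps_power_zeroth)
  moreover have "integral_fps (poincare_series I)"
    by (simp add: integral_fps_def poincare_series_def)
  ultimately obtain \<epsilon> where \<epsilon>: "\<epsilon> 0 = 0" "has_deviations (poincare_series I) \<epsilon>"
    using deviations_exist by blast
  have "deviation I = \<epsilon>"
    unfolding deviation_def using \<epsilon> deviations_unique by (intro the_equality) auto
  with golod_series_deviations[OF n b P \<epsilon>(2)] show ?thesis by simp
qed

section \<open>Finite generation of submodules of free modules over a polynomial ring\<close>

lemma sum_monomials: "(\<Sum>m\<in>Poly_Mapping.keys h. Poly_Mapping.single m (Poly_Mapping.lookup h m)) = h"
  for h :: "'a \<Rightarrow>\<^sub>0 'b::comm_monoid_add"
proof (rule poly_mapping_eqI)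
  fix k
  have "Poly_Mapping.lookup (\<Sum>m\<in>Poly_Mapping.keys h. Poly_Mapping.single m (Poly_Mapping.lookup h m)) k
      = (\<Sum>m\<in>Poly_Mapping.keys h. if m = k then Poly_Mapping.lookup h k else 0)"
    unfolding lookup_sum lookup_single by (intro sum.cong) (auto simp: when_def)
  also have "\<dots> = Poly_Mapping.lookup h k"
    by (simp add: in_keys_iff)
  finally show "Poly_Mapping.lookup (\<Sum>m\<in>Poly_Mapping.keys h. Poly_Mapping.single m (Poly_Mapping.lookup h m)) k
      = Poly_Mapping.lookup h k" .
qed

lemma lookup_mult_keys:
  fixes a b :: "'a::comm_monoid_add \<Rightarrow>\<^sub>0 'b::comm_semiring_1"
  shows "Poly_Mapping.lookup (a * b) e = (\<Sum>m\<in>Poly_Mapping.keys a. \<Sum>m'\<in>Poly_Mapping.keys b.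
    if m + m' = e then Poly_Mapping.lookup a m * Poly_Mapping.lookup b m' else 0)"
proof -
  have "a * b = (\<Sum>m\<in>Poly_Mapping.keys a. Poly_Mapping.single m (Poly_Mapping.lookup a m)) *
      (\<Sum>m'\<in>Poly_Mapping.keys b. Poly_Mapping.single m' (Poly_Mapping.lookup b m'))"
    by (simp only: sum_monomials)
  also have "\<dots> = (\<Sum>m\<in>Poly_Mapping.keys a. \<Sum>m'\<in>Poly_Mapping.keys b.
      Poly_Mapping.single (m + m') (Poly_Mapping.lookup a m * Poly_Mapping.lookup b m'))"
    by (simp add: sum_product mult_single)
  finally show ?thesis by (simp add: lookup_sum lookup_single when_def)
qed

lemma lookup_single_times:
  fixes h :: "'a::cancel_comm_monoid_add \<Rightarrow>\<^sub>0 'b::comm_semiring_1"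
  shows "Poly_Mapping.lookup (Poly_Mapping.single t c * h) (t + x) = c * Poly_Mapping.lookup h x"
proof (cases "c = 0")
  case False
  have "Poly_Mapping.lookup (Poly_Mapping.single t c * h) (t + x) =
      (\<Sum>m\<in>Poly_Mapping.keys h. if m = x then c * Poly_Mapping.lookup h x else 0)"
    unfolding lookup_mult_keys using False by (auto simp: keys_single intro!: sum.cong)
  then show ?thesis by (simp add: in_keys_iff)
qed simp

lemma lookup_single_times_neq_0:
  fixes h :: "'a::comm_monoid_add \<Rightarrow>\<^sub>0 'b::comm_semiring_1"
  assumes "Poly_Mapping.lookup (Poly_Mapping.single t c * h) y \<noteq> 0"
  shows "\<exists>x. y = t + x \<and> Poly_Mapping.lookup h x \<noteq> 0"
proof -
  from assms have "y \<in> Poly_Mapping.keys (Poly_Mapping.single t c * h)" by (simp add: in_keys_iff)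
  then obtain m x where "m \<in> Poly_Mapping.keys (Poly_Mapping.single t c)" "x \<in> Poly_Mapping.keys h" "y = m + x"
    using keys_mult by blast
  then show ?thesis by (auto simp: in_keys_iff split: if_splits)
qed

text \<open>
Induction on the set of coordinates.  Let \<open>B\<close> be a solution that ignores the new coordinate \<open>v\<close>, and
let \<open>m\<close> bound the value of \<open>v\<close> on \<open>B\<close>.  Elements with value at least \<open>m\<close> at \<open>v\<close> are still dominated
by \<open>B\<close>, and for each of the finitely many smaller values one more application of the induction
hypothesis suffices.
\<close>

lemma dickson:
  fixes w :: "'a \<Rightarrow> 'j \<Rightarrow> nat"
  assumes "finite J"
  shows "\<exists>B\<subseteq>A. finite B \<and> (\<forall>a\<in>A. \<exists>b\<in>B. \<forall>j\<in>J. w b j \<le> w a j)"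
  using assms
proof (induction J arbitrary: A rule: finite_induct)
  case empty
  show ?case
  proof (cases "A = {}")
    case False
    then obtain a where "a \<in> A" by blast
    then show ?thesis by (intro exI[of _ "{a}"]) auto
  qed auto
next
  case (insert v J)
  obtain B where B: "B \<subseteq> A" "finite B" "\<forall>a\<in>A. \<exists>b\<in>B. \<forall>j\<in>J. w b j \<le> w a j"
    using insert.IH by blast
  obtain m where m: "\<And>b. b \<in> B \<Longrightarrow> w b v \<le> m"
    using B(2) by (meson finite_imageI finite_nat_set_iff_bounded_le imageI)
  have "\<forall>i. \<exists>C\<subseteq>{a \<in> A. w a v = i}. finite C \<and> (\<forall>a\<in>{a \<in> A. w a v = i}. \<exists>b\<in>C. \<forall>j\<in>J. w b j \<le> w a j)"
    using insert.IH by blast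
  from choice[OF this] obtain C where "\<forall>i. C i \<subseteq> {a \<in> A. w a v = i} \<and> finite (C i) \<and>
      (\<forall>a\<in>{a \<in> A. w a v = i}. \<exists>b\<in>C i. \<forall>j\<in>J. w b j \<le> w a j)" by blast
  then have C: "\<And>i. C i \<subseteq> {a \<in> A. w a v = i}" "\<And>i. finite (C i)"
    "\<And>i a. a \<in> A \<Longrightarrow> w a v = i \<Longrightarrow> \<exists>b\<in>C i. \<forall>j\<in>J. w b j \<le> w a j"
    by blast+
  show ?case
  proof (intro exI[of _ "B \<union> (\<Union>i<m. C i)"] conjI ballI)
    show "B \<union> (\<Union>i<m. C i) \<subseteq> A" using B C(1) by blast
    show "finite (B \<union> (\<Union>i<m. C i))" using B C(2) by auto
    fix a assume a: "a \<in> A"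
    show "\<exists>b\<in>B \<union> (\<Union>i<m. C i). \<forall>j\<in>insert v J. w b j \<le> w a j"
    proof (cases "w a v < m")
      case True
      obtain b where b: "b \<in> C (w a v)" "\<forall>j\<in>J. w b j \<le> w a j" using C(3)[OF a refl] by blast
      then have "w b v = w a v" using C(1) by blast
      then show ?thesis using b True by (intro bexI[of _ b]) auto
    next
      case False
      obtain b where b: "b \<in> B" "\<forall>j\<in>J. w b j \<le> w a j" using B(3) a by blast
      then have "w b v \<le> w a v" using m[of b] False by simp
      then show ?thesis using b by (intro bexI[of _ b]) auto
    qed
  qed
qed

text \<open>
A monomial order without a chosen order of the variables: assign distinct primes to the variables
and a monomial to the product of the corresponding prime powers.  By unique factorisation this embeds
the monomials into the multiplicative monoid of the positive integers, so comparing numbers gives a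
well-order that is compatible with multiplication.
\<close>

lemma monomial_numbering:
  "\<exists>N :: ('n::finite \<Rightarrow>\<^sub>0 nat) \<Rightarrow> nat. inj N \<and> (\<forall>a b. N (a + b) = N a * N b) \<and> (\<forall>a. N a > 0)"
proof -
  obtain B where B: "finite B" "card B = CARD('n)" "B \<subseteq> {p::nat. prime p}"
    using infinite_arbitrarily_large[OF primes_infinite] by metis
  then obtain f where f: "bij_betw f (UNIV :: 'n set) B"
    using finite_same_card_bij[of "UNIV :: 'n set" B] by auto
  have prime: "prime (f j)" for j using f B(3) by (auto simp: bij_betw_def)
  have inj: "inj f" using f by (simp add: bij_betw_def)
  define N where "N e = (\<Prod>j\<in>UNIV. f j ^ Poly_Mapping.lookup e j)" for e :: "'n \<Rightarrow>\<^sub>0 nat"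
  have mult: "multiplicity (f i) (N e) = Poly_Mapping.lookup e i" for e i
  proof -
    have N_range: "N e = (\<Prod>p\<in>range f. p ^ Poly_Mapping.lookup e (inv_into UNIV f p))"
      unfolding N_def using inj by (subst prod.reindex) (auto simp: inv_f_f)
    show ?thesis
      unfolding N_range using prime inj by (subst multiplicity_prod_prime_powers) (auto simp: inv_f_f)
  qed
  have "inj N"
  proof (rule injI)
    fix a b assume "N a = N b"
    then show "a = b" by (intro poly_mapping_eqI) (metis mult)
  qed
  moreover have "N (a + b) = N a * N b" for a b
    by (simp add: N_def lookup_add power_add prod.distrib)
  moreover have "N a > 0" for a
    using prime by (auto simp: N_def intro!: prod_pos prime_gt_0_nat)
  ultimately show ?thesis by blast
qed

text \<open>
Vectors of length \<open>b\<close> are sequences vanishing from \<open>b\<close> on, in agreement with \<^const>\<open>dsum\<close>.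
\<close>

definition free_mod :: "nat \<Rightarrow> (nat \<Rightarrow> 'r::zero) set" where
  "free_mod b = {v. \<forall>p\<ge>b. v p = 0}"

definition scale :: "'r::times \<Rightarrow> (nat \<Rightarrow> 'r) \<Rightarrow> nat \<Rightarrow> 'r" where
  "scale a v = (\<lambda>p. a * v p)"

definition submod :: "(nat \<Rightarrow> 'r::comm_ring_1) set \<Rightarrow> bool" where
  "submod M \<longleftrightarrow> 0 \<in> M \<and> (\<forall>x\<in>M. \<forall>y\<in>M. x + y \<in> M) \<and> (\<forall>a. \<forall>x\<in>M. scale a x \<in> M)"

lemma submod_add: "submod M \<Longrightarrow> x \<in> M \<Longrightarrow> y \<in> M \<Longrightarrow> x + y \<in> M"
  and submod_scale: "submod M \<Longrightarrow> x \<in> M \<Longrightarrow> scale a x \<in> M"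
  and submod_0: "submod M \<Longrightarrow> 0 \<in> M"
  by (auto simp: submod_def)

lemma submod_diff: "submod M \<Longrightarrow> x \<in> M \<Longrightarrow> y \<in> M \<Longrightarrow> x - y \<in> M"
proof -
  assume a: "submod M" "x \<in> M" "y \<in> M"
  have "x + scale (- 1) y \<in> M" using a by (intro submod_add submod_scale)
  moreover have "x + scale (- 1) y = x - y" by (auto simp: scale_def)
  ultimately show ?thesis by (simp only:)
qed

lemma submod_sum: "submod M \<Longrightarrow> (\<And>i. i \<in> A \<Longrightarrow> x i \<in> M) \<Longrightarrow> sum x A \<in> M"
  by (induction A rule: infinite_finite_induct) (auto simp: submod_0 submod_add)

lemma sum_fun_apply: "sum f A x = (\<Sum>i\<in>A. f i x)"
  by (induction A rule: infinite_finite_induct) auto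

text \<open>
The Noetherian property, by division with respect to leading terms.  A term is a pair of a position
and a monomial, and terms are ordered by their \<open>code\<close>.  Dickson's lemma, applied for each position,
provides finitely many elements of \<open>M\<close> such that every leading term of \<open>M\<close> is a multiple of one of
theirs.  Subtracting a multiple of such an element lowers the leading term, so these elements generate \<open>M\<close>.
\<close>

lemma submod_finitely_generated:
  fixes M :: "(nat \<Rightarrow> ('n::finite, 'k::field) mpoly) set"
  assumes M: "submod M" "M \<subseteq> free_mod b"
  shows "\<exists>G\<subseteq>M. finite G \<and> (\<forall>M'. submod M' \<longrightarrow> G \<subseteq> M' \<longrightarrow> M \<subseteq> M')"
proof -
  obtain N :: "('n \<Rightarrow>\<^sub>0 nat) \<Rightarrow> nat" where
    N: "inj N" "\<And>a b. N (a + b) = N a * N b" "\<And>a. N a > 0" using monomial_numbering by blast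
  \<comment> \<open>As positions are below \<open>b\<close>, this compares monomials first and positions second.\<close>
  define code where "code p e = N e * b + p" for p e
  have code_inj: "p = p' \<and> e = e'" if "code p e = code p' e'" "p < b" "p' < b" for p p' e e'
  proof -
    have "code p e mod b = p" "code p' e' mod b = p'" "code p e div b = N e" "code p' e' div b = N e'"
      using that(2,3) by (auto simp: code_def)
    then show ?thesis using that(1) N(1) by (metis injD)
  qed
  have code_shift: "code p' (t + e') \<le> code p (t + e)" if le: "code p' e' \<le> code p e" and "p < b" "p' < b" for p p' e e' t
  proof -
    have "N e' \<le> N e"
    proof (rule ccontr)
      assume "\<not> N e' \<le> N e"
      then have "(N e + 1) * b \<le> N e' * b" by (intro mult_le_mono1) simp
      then show False using le \<open>p < b\<close> by (simp add: code_def)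
    qed
    show ?thesis
    proof (cases "N e' = N e")
      case True then show ?thesis using le by (simp add: code_def N)
    next
      case False
      then have "N t * N e' + 1 \<le> N t * N e"
        using \<open>N e' \<le> N e\<close> N(3)[of t] by (simp add: Suc_le_eq)
      then have "(N t * N e' + 1) * b \<le> N t * N e * b" by (rule mult_le_mono1)
      then show ?thesis using \<open>p' < b\<close> by (simp add: code_def N)
    qed
  qed
  have supp: "p < b" if "v \<in> M" "Poly_Mapping.lookup (v p) e \<noteq> 0" for v p e
    using that M(2) by (force simp: free_mod_def not_le[symmetric])
  define leads where "leads v p e \<longleftrightarrow> Poly_Mapping.lookup (v p) e \<noteq> 0 \<and>
      (\<forall>p' e'. Poly_Mapping.lookup (v p') e' \<noteq> 0 \<longrightarrow> code p' e' \<le> code p e)"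
    for v :: "nat \<Rightarrow> ('n, 'k) mpoly" and p e
  have "\<exists>B\<subseteq>{(v, e). v \<in> M \<and> leads v p e}. finite B \<and> (\<forall>x\<in>{(v, e). v \<in> M \<and> leads v p e}.
        \<exists>y\<in>B. \<forall>j\<in>UNIV. Poly_Mapping.lookup (snd y) j \<le> Poly_Mapping.lookup (snd x) j)" for p
    by (rule dickson) simp
  then have "\<forall>p. \<exists>B\<subseteq>{(v, e). v \<in> M \<and> leads v p e}. finite B \<and> (\<forall>x\<in>{(v, e). v \<in> M \<and> leads v p e}.
        \<exists>y\<in>B. \<forall>j\<in>UNIV. Poly_Mapping.lookup (snd y) j \<le> Poly_Mapping.lookup (snd x) j)" by blast
  from choice[OF this] obtain B where B: "\<And>p. B p \<subseteq> {(v, e). v \<in> M \<and> leads v p e}" "\<And>p. finite (B p)"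
    "\<And>p x. x \<in> {(v, e). v \<in> M \<and> leads v p e} \<Longrightarrow>
        \<exists>y\<in>B p. \<forall>j\<in>UNIV. Poly_Mapping.lookup (snd y) j \<le> Poly_Mapping.lookup (snd x) j"
    by blast
  define G where "G = fst ` (\<Union>p<b. B p)"
  have "v \<in> M'" if M': "submod M'" "G \<subseteq> M'" and v: "v \<in> M"
    and k: "\<forall>p e. Poly_Mapping.lookup (v p) e \<noteq> 0 \<longrightarrow> code p e < k" for M' v k
    using v k
  proof (induction k arbitrary: v)
    case 0
    then have "v = 0" by (intro ext poly_mapping_eqI) auto
    with submod_0[OF M'(1)] show ?case by (simp only:)
  next
    case (Suc k)
    show ?case
    proof (cases "\<exists>p e. Poly_Mapping.lookup (v p) e \<noteq> 0 \<and> code p e = k")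
      case False
      then show ?thesis using Suc.prems by (intro Suc.IH) (auto simp: less_Suc_eq)
    next
      case True
      then obtain p e where pe: "Poly_Mapping.lookup (v p) e \<noteq> 0" "code p e = k" by blast
      then have "leads v p e" using Suc.prems(2) by (auto simp: leads_def less_Suc_eq_le)
      then obtain g e' where g: "(g, e') \<in> B p" and le: "\<forall>j. Poly_Mapping.lookup e' j \<le> Poly_Mapping.lookup e j"
        using B(3)[of "(v, e)" p] Suc.prems(1) by auto
      have gM: "g \<in> M" "leads g p e'" using g B(1) by auto
      have pb: "p < b" using supp Suc.prems(1) pe(1) by blast
      then have gM': "g \<in> M'" using g M'(2) by (force simp: G_def)
      define t where "t = e - e'"
      have e: "e = t + e'" using le by (intro poly_mapping_eqI) (simp add: t_def lookup_add lookup_minus)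
      define c where "c = Poly_Mapping.lookup (v p) e / Poly_Mapping.lookup (g p) e'"
      define v' where "v' = v - scale (Poly_Mapping.single t c) g"
      have "v' \<in> M'"
      proof (rule Suc.IH)
        show "v' \<in> M" unfolding v'_def using Suc.prems(1) gM M by (intro submod_diff submod_scale)
        show "\<forall>p' x. Poly_Mapping.lookup (v' p') x \<noteq> 0 \<longrightarrow> code p' x < k"
        proof (intro allI impI)
          fix p' x assume nz: "Poly_Mapping.lookup (v' p') x \<noteq> 0"
          then have p'b: "p' < b" using supp \<open>v' \<in> M\<close> by blast
          have v'x: "Poly_Mapping.lookup (v' p') x =
              Poly_Mapping.lookup (v p') x - Poly_Mapping.lookup (Poly_Mapping.single t c * g p') x"
            by (simp add: v'_def scale_def lookup_minus)
          have "code p' x \<le> k"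
          proof (cases "Poly_Mapping.lookup (v p') x = 0")
            case True
            then have "Poly_Mapping.lookup (Poly_Mapping.single t c * g p') x \<noteq> 0" using nz v'x by simp
            then obtain y where y: "x = t + y" "Poly_Mapping.lookup (g p') y \<noteq> 0"
              using lookup_single_times_neq_0 by blast
            then have "code p' y \<le> code p e'" using gM(2) by (simp add: leads_def)
            then have "code p' x \<le> code p e" using code_shift pb p'b by (simp add: y e)
            then show ?thesis using pe by simp
          next
            case False then show ?thesis using Suc.prems(2) by (simp add: less_Suc_eq_le)
          qed
          moreover have "code p' x \<noteq> k"
          proof
            assume "code p' x = k"
            then have eq: "p' = p" "x = e" using code_inj[of p' x p e] pe pb p'b by auto
            have "Poly_Mapping.lookup (g p) e' \<noteq> 0" using gM(2) by (simp add: leads_def)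
            then show False using nz v'x unfolding eq
              by (simp add: e lookup_single_times c_def)
          qed
          ultimately show "code p' x < k" by simp
        qed
      qed
      moreover have "v = v' + scale (Poly_Mapping.single t c) g" by (simp add: v'_def)
      ultimately show ?thesis using M' gM' by (metis submod_add submod_scale)
    qed
  qed note gen = this
  have bounded: "\<exists>k. \<forall>p e. Poly_Mapping.lookup (v p) e \<noteq> 0 \<longrightarrow> code p e < k" if "v \<in> M" for v
  proof -
    define S where "S = (\<Union>p<b. code p ` Poly_Mapping.keys (v p))"
    have "finite S" by (simp add: S_def)
    then obtain k where k: "\<And>s. s \<in> S \<Longrightarrow> s < k" by (meson finite_nat_set_iff_bounded)
    have "code p e < k" if "Poly_Mapping.lookup (v p) e \<noteq> 0" for p e
    proof (rule k)
      have "e \<in> Poly_Mapping.keys (v p)" using that by (simp add: in_keys_iff)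
      then show "code p e \<in> S" unfolding S_def using supp[OF \<open>v \<in> M\<close> that] by blast
    qed
    then show ?thesis by blast
  qed
  show ?thesis
  proof (intro exI[of _ G] conjI allI impI)
    show "G \<subseteq> M" using B(1) by (force simp: G_def)
    show "finite G" using B(2) by (auto simp: G_def)
    show "M \<subseteq> M'" if "submod M'" "G \<subseteq> M'" for M' using gen[OF that] bounded by blast
  qed
qed

text \<open>
The matrix \<open>A\<close> as a map of free modules, written with the operations of the type class instead of those
of a module record.
\<close>

definition lin_map :: "nat \<Rightarrow> nat \<Rightarrow> (nat \<Rightarrow> nat \<Rightarrow> 'r) \<Rightarrow> (nat \<Rightarrow> 'r) \<Rightarrow> nat \<Rightarrow> 'r::comm_ring_1" where
  "lin_map r c A v = (\<lambda>p. if p < r then \<Sum>q<c. A p q * v q else 0)"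

lemma lin_map_add: "lin_map r c A (x + y) = lin_map r c A x + lin_map r c A y"
  by (auto simp: lin_map_def sum.distrib algebra_simps)

lemma lin_map_diff: "lin_map r c A (x - y) = lin_map r c A x - lin_map r c A y"
  by (auto simp: lin_map_def sum_subtractf algebra_simps)

lemma lin_map_scale: "lin_map r c A (scale a x) = scale a (lin_map r c A x)"
  by (auto simp: lin_map_def scale_def sum_distrib_left mult_ac)

lemma lin_map_0: "lin_map r c A 0 = 0"
  by (auto simp: lin_map_def)

lemma lin_map_free: "lin_map r c A v \<in> free_mod r"
  by (simp add: lin_map_def free_mod_def)

lemma submod_free: "submod (free_mod b)"
  by (auto simp: submod_def free_mod_def scale_def)

lemma submod_lin_image:
  assumes "submod M" shows "submod (lin_map r c A ` M)"
  unfolding submod_def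
proof (intro conjI ballI allI)
  show "0 \<in> lin_map r c A ` M" using assms lin_map_0 by (metis imageI submod_0)
next
  fix x y assume "x \<in> lin_map r c A ` M" "y \<in> lin_map r c A ` M"
  then show "x + y \<in> lin_map r c A ` M"
    using assms by (auto simp: submod_add simp flip: lin_map_add)
next
  fix a x assume "x \<in> lin_map r c A ` M"
  then show "scale a x \<in> lin_map r c A ` M"
    using assms by (auto simp: submod_scale simp flip: lin_map_scale)
qed

lemma submod_kernel: "submod {v \<in> free_mod c. lin_map r c A v = 0}"
  unfolding submod_def
  by (auto simp: lin_map_add lin_map_scale lin_map_0 submod_add[OF submod_free] submod_scale[OF submod_free] submod_0[OF submod_free])
     (auto simp: scale_def)

lemma submod_eq_lin_image:
  fixes M :: "(nat \<Rightarrow> ('n::finite, 'k::field) mpoly) set"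
  assumes M: "submod M" "M \<subseteq> free_mod b"
  shows "\<exists>c A. M = lin_map b c A ` free_mod c"
proof -
  obtain G where G: "G \<subseteq> M" "finite G" "\<And>M'. submod M' \<Longrightarrow> G \<subseteq> M' \<Longrightarrow> M \<subseteq> M'"
    using submod_finitely_generated[OF M] by blast
  obtain g where g: "bij_betw g {..<card G} G"
    using ex_bij_betw_nat_finite[OF G(2)] by (auto simp: atLeast0LessThan)
  let ?c = "card G" and ?A = "\<lambda>p q. g q p"
  have col: "lin_map b ?c ?A v = (\<Sum>q<?c. scale (v q) (g q))" for v
  proof
    fix p
    have gp: "g q p = 0" if "q < ?c" "\<not> p < b" for q
      using that g G(1) M(2) by (force simp: bij_betw_def free_mod_def)
    show "lin_map b ?c ?A v p = (\<Sum>q<?c. scale (v q) (g q)) p"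
    proof (cases "p < b")
      case True then show ?thesis by (simp add: lin_map_def scale_def mult.commute sum_fun_apply)
    next
      case False then show ?thesis using gp by (simp add: lin_map_def scale_def sum_fun_apply)
    qed
  qed
  have "M \<subseteq> lin_map b ?c ?A ` free_mod ?c"
  proof (rule G(3)[OF submod_lin_image[OF submod_free]])
    show "G \<subseteq> lin_map b ?c ?A ` free_mod ?c"
    proof
      fix x assume "x \<in> G"
      then obtain i where i: "i < ?c" "x = g i" using g by (auto simp: bij_betw_def)
      have "lin_map b ?c ?A (\<lambda>q. if q = i then 1 else 0) = (\<Sum>q<?c. if q = i then x else 0)"
        unfolding col by (intro sum.cong) (auto simp: scale_def i)
      also have "\<dots> = x" using i by simp
      finally have "lin_map b ?c ?A (\<lambda>q. if q = i then 1 else 0) = x" .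
      moreover have "(\<lambda>q. if q = i then 1 else 0) \<in> free_mod ?c" using i by (auto simp: free_mod_def)
      ultimately show "x \<in> lin_map b ?c ?A ` free_mod ?c" by (rule image_eqI[OF sym])
    qed
  qed
  moreover have "lin_map b ?c ?A ` free_mod ?c \<subseteq> M"
    unfolding col using g G(1) M(1) by (auto simp: bij_betw_def intro!: submod_sum submod_scale)
  ultimately show ?thesis by blast
qed

section \<open>Free resolutions of a quotient of a ring\<close>

lemma ring_of_type_simps [simp]:
  "carrier ring_of_type_algebra = UNIV" "monoid.mult ring_of_type_algebra = (*)"
  "one ring_of_type_algebra = 1" "zero ring_of_type_algebra = 0" "add ring_of_type_algebra = (+)"
  by (simp_all add: ring_of_type_algebra_def)

lemma finsum_type:
  fixes f :: "'b \<Rightarrow> 'a::ab_group_add"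
  assumes N: "carrier N = UNIV" "add N = (+)" "zero N = 0" and A: "finite A"
  shows "finsum N f A = sum f A"
proof -
  interpret abelian_monoid N
    by (rule abelian_monoidI) (auto simp: N add_ac)
  show ?thesis using A by (induction A rule: finite_induct) (auto simp: N)
qed

lemma dsum_regular: "dsum (regular_module ring_of_type_algebra) c = free_mod c"
  by (auto simp: dsum_def free_mod_def regular_module_def)

lemma zero_regular: "\<zero>\<^bsub>regular_module ring_of_type_algebra\<^esub> = 0"
  by (simp add: regular_module_def)

lemma mat_act_regular:
  fixes A :: "nat \<Rightarrow> nat \<Rightarrow> 'r::comm_ring_1"
  shows "mat_act (regular_module ring_of_type_algebra) r c A v = lin_map r c A v"
  unfolding mat_act_def lin_map_def
  by (subst finsum_type) (auto simp: regular_module_def fun_eq_iff)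

lemma dsum_field: "dsum (field_module \<chi>) c = free_mod c"
  by (auto simp: dsum_def free_mod_def field_module_def)

lemma mat_act_field: "mat_act (field_module \<chi>) r c A v = lin_map r c (\<lambda>p q. \<chi> (A p q)) v"
  unfolding mat_act_def lin_map_def
  by (subst finsum_type) (auto simp: field_module_def fun_eq_iff)

context
  fixes I :: "'r::comm_ring_1 set"
  assumes I: "ideal I ring_of_type_algebra"
begin

lemma ideal_0: "0 \<in> I" and ideal_add: "x \<in> I \<Longrightarrow> y \<in> I \<Longrightarrow> x + y \<in> I"
  and ideal_mult: "x \<in> I \<Longrightarrow> a * x \<in> I"
proof -
  interpret ideal I "ring_of_type_algebra :: 'r ring" by (rule I)
  show "0 \<in> I" using additive_subgroup.zero_closed[OF additive_subgroup_axioms] by simp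
  show "x \<in> I \<Longrightarrow> y \<in> I \<Longrightarrow> x + y \<in> I"
    using additive_subgroup.a_closed[OF additive_subgroup_axioms, of x y] by simp
  show "x \<in> I \<Longrightarrow> a * x \<in> I" using I_l_closed[of x a] by simp
qed

lemma coset_eq_iff: "I +>\<^bsub>ring_of_type_algebra\<^esub> a = I +>\<^bsub>ring_of_type_algebra\<^esub> b \<longleftrightarrow> a - b \<in> I"
proof
  assume "I +>\<^bsub>ring_of_type_algebra\<^esub> a = I +>\<^bsub>ring_of_type_algebra\<^esub> b"
  moreover have "a \<in> I +>\<^bsub>ring_of_type_algebra\<^esub> a"
    using ideal_0 by (auto simp: a_r_coset_def r_coset_def)
  ultimately obtain h where "h \<in> I" "a = h + b" by (auto simp: a_r_coset_def r_coset_def)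
  then show "a - b \<in> I" by simp
next
  assume ab: "a - b \<in> I"
  have *: "I +>\<^bsub>ring_of_type_algebra\<^esub> a \<subseteq> I +>\<^bsub>ring_of_type_algebra\<^esub> b" if "a - b \<in> I" for a b
  proof
    fix x assume "x \<in> I +>\<^bsub>ring_of_type_algebra\<^esub> a"
    then obtain h where h: "h \<in> I" "x = h + a" by (auto simp: a_r_coset_def r_coset_def)
    then have "x = (h + (a - b)) + b" by simp
    moreover have "h + (a - b) \<in> I" using h that by (intro ideal_add)
    ultimately show "x \<in> I +>\<^bsub>ring_of_type_algebra\<^esub> b"
      by (auto simp: a_r_coset_def r_coset_def intro!: bexI[of _ "h + (a - b)"])
  qed
  have "b - a \<in> I" using ideal_mult[OF ab, of "-1"] by simp
  with ab show "I +>\<^bsub>ring_of_type_algebra\<^esub> a = I +>\<^bsub>ring_of_type_algebra\<^esub> b"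
    using * by blast
qed

text \<open>
The map from \<open>F\<^sub>0\<close> to the quotient lifts to a map into the ring, once a representative \<open>E q\<close>
of each generator is chosen.
\<close>

lemma augmentation_quotient:
  assumes e: "\<And>q. q < c \<Longrightarrow> e q = I +>\<^bsub>ring_of_type_algebra\<^esub> E q"
  shows "augmentation (quotient_module ring_of_type_algebra I) c e v
    = I +>\<^bsub>ring_of_type_algebra\<^esub> (\<Sum>q<c. v q * E q)"
  using e
proof -
  let ?R = "ring_of_type_algebra :: 'r ring" and ?Q = "ring_of_type_algebra Quot I"
  interpret I: ideal I ?R by (rule I)
  interpret Q: ring ?Q by (rule I.quotient_is_ring)
  have hom: "(+>\<^bsub>?R\<^esub>) I \<in> ring_hom ?R ?Q" by (rule I.rcos_ring_hom)
  note hom_simps = ring_hom_mult[OF hom] ring_hom_add[OF hom]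
  have closed: "I +>\<^bsub>?R\<^esub> a \<in> carrier ?Q" for a using ring_hom_closed[OF hom] by simp
  have "finsum (quotient_module ?R I) f A = finsum ?Q f A" for f :: "nat \<Rightarrow> _" and A
    by (simp add: finsum_def finprod_def quotient_module_def)
  then have "augmentation (quotient_module ?R I) c e v = finsum ?Q (\<lambda>q. (I +>\<^bsub>?R\<^esub> v q) \<otimes>\<^bsub>?Q\<^esub> e q) {..<c}"
    by (simp add: augmentation_def quotient_module_def)
  also have "\<dots> = finsum ?Q (\<lambda>q. I +>\<^bsub>?R\<^esub> (v q * E q)) {..<c}"
    using e hom_simps closed by (intro Q.finsum_cong') auto
  also have "\<dots> = I +>\<^bsub>?R\<^esub> (\<Sum>q<c. v q * E q)"
  proof (induction c)
    case 0
    show ?case using ring_hom_zero[OF hom I.ring_axioms Q.ring_axioms] by simp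
  next
    case (Suc c)
    then show ?case using hom_simps closed
      by (simp add: lessThan_Suc add.commute)
  qed
  finally show ?thesis .
qed

lemma quotient_module_carrier: "carrier (quotient_module ring_of_type_algebra I) = range ((+>\<^bsub>ring_of_type_algebra\<^esub>) I)"
  by (auto simp: quotient_module_def FactRing_def A_RCOSETS_def' a_r_coset_def r_coset_def)

lemma free_resolution_iff:
  assumes e: "\<And>q. q < b 0 \<Longrightarrow> e q = I +>\<^bsub>ring_of_type_algebra\<^esub> E q"
  shows "free_resolution ring_of_type_algebra (quotient_module ring_of_type_algebra I) b D e \<longleftrightarrow>
    (\<forall>a. \<exists>v\<in>free_mod (b 0). (\<Sum>q<b 0. v q * E q) - a \<in> I) \<and>
    {v \<in> free_mod (b 0). (\<Sum>q<b 0. v q * E q) \<in> I} = lin_map (b 0) (b 1) (D 0) ` free_mod (b 1) \<and>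
    (\<forall>i. {v \<in> free_mod (b (Suc i)). lin_map (b i) (b (Suc i)) (D i) v = 0} =
      lin_map (b (Suc i)) (b (Suc (Suc i))) (D (Suc i)) ` free_mod (b (Suc (Suc i))))"
proof -
  let ?Q = "quotient_module ring_of_type_algebra I"
  have z: "\<zero>\<^bsub>?Q\<^esub> = I +>\<^bsub>ring_of_type_algebra\<^esub> 0"
    by (auto simp: quotient_module_def FactRing_def a_r_coset_def r_coset_def)
  have aug: "augmentation ?Q (b 0) e = (\<lambda>v. I +>\<^bsub>ring_of_type_algebra\<^esub> (\<Sum>q<b 0. v q * E q))"
    by (rule ext) (rule augmentation_quotient[OF e])
  have "(augmentation ?Q (b 0) e ` free_mod (b 0) = carrier ?Q) \<longleftrightarrow>
      (\<forall>a. \<exists>v\<in>free_mod (b 0). (\<Sum>q<b 0. v q * E q) - a \<in> I)"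
  proof -
    let ?coset = "(+>\<^bsub>ring_of_type_algebra\<^esub>) I" and ?s = "\<lambda>v. \<Sum>q<b 0. v q * E q"
    have "(\<lambda>v. ?coset (?s v)) ` free_mod (b 0) = range ?coset \<longleftrightarrow>
        (\<forall>a. \<exists>v\<in>free_mod (b 0). ?coset a = ?coset (?s v))"
      (is "?im = _ \<longleftrightarrow> _")
    proof
      assume "?im = range ?coset"
      then have "?coset a \<in> ?im" for a by simp
      then show "\<forall>a. \<exists>v\<in>free_mod (b 0). ?coset a = ?coset (?s v)" by blast
    next
      assume "\<forall>a. \<exists>v\<in>free_mod (b 0). ?coset a = ?coset (?s v)"
      then have "?coset a \<in> ?im" for a by blast
      then show "?im = range ?coset" by blast
    qed
    also have "\<dots> \<longleftrightarrow> (\<forall>a. \<exists>v\<in>free_mod (b 0). ?coset (?s v) = ?coset a)"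
      by (subst eq_commute) (rule refl)
    finally have "?im = range ?coset \<longleftrightarrow> (\<forall>a. \<exists>v\<in>free_mod (b 0). ?coset (?s v) = ?coset a)" .
    then show ?thesis by (simp only: aug quotient_module_carrier coset_eq_iff)
  qed
  moreover have "{v \<in> free_mod (b 0). augmentation ?Q (b 0) e v = \<zero>\<^bsub>?Q\<^esub>} =
      {v \<in> free_mod (b 0). (\<Sum>q<b 0. v q * E q) \<in> I}"
    unfolding z aug coset_eq_iff by simp
  moreover have "cycles (regular_module ring_of_type_algebra) b D (Suc i) =
      {v \<in> free_mod (b (Suc i)). lin_map (b i) (b (Suc i)) (D i) v = 0}" for i
    by (simp add: cycles_def dsum_regular mat_act_regular zero_regular zero_fun_def)
  moreover have "boundaries (regular_module ring_of_type_algebra) b D i =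
      lin_map (b i) (b (Suc i)) (D i) ` free_mod (b (Suc i))" for i
    unfolding boundaries_def dsum_regular mat_act_regular by simp
  moreover have "\<forall>q<b 0. e q \<in> carrier ?Q" using e by (auto simp: quotient_module_carrier)
  ultimately show ?thesis
    unfolding free_resolution_def dsum_regular by simp
qed

end

lemma free_resolution_representatives:
  fixes I :: "'r::comm_ring_1 set"
  assumes "free_resolution ring_of_type_algebra (quotient_module ring_of_type_algebra I) b D e"
    and I: "ideal I ring_of_type_algebra"
  obtains E where "\<And>q. q < b 0 \<Longrightarrow> e q = I +>\<^bsub>ring_of_type_algebra\<^esub> E q"
proof -
  have "\<forall>q<b 0. e q \<in> range ((+>\<^bsub>ring_of_type_algebra\<^esub>) I)"
    using assms by (simp add: free_resolution_def quotient_module_carrier[OF I])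
  then have "\<forall>q. \<exists>a. q < b 0 \<longrightarrow> e q = I +>\<^bsub>ring_of_type_algebra\<^esub> a" by blast
  from choice[OF this] show ?thesis using that by blast
qed

text \<open>
Start from \<open>S \<rightarrow> S/I\<close> and repeatedly choose a matrix whose columns generate the kernel of the previous
matrix.
\<close>

lemma free_resolution_exists:
  fixes I :: "('n::finite, 'k::field) mpoly set"
  assumes I: "ideal I mpoly_ring"
  shows "\<exists>b D e. free_resolution mpoly_ring (quotient_module mpoly_ring I) b D e"
proof -
  define M where "M = {v \<in> free_mod 1. v 0 \<in> I}"
  have "submod M"
    using submod_free[of 1, where 'a = "('n, 'k) mpoly"] ideal_0[OF I] ideal_add[OF I] ideal_mult[OF I]
    by (auto simp: submod_def M_def scale_def zero_fun_def)
  then obtain c0 A0 where A0: "M = lin_map 1 c0 A0 ` free_mod c0"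
    using submod_eq_lin_image[of M 1] by (auto simp: M_def)
  define good where "good r c A c' A' \<longleftrightarrow>
      {v \<in> free_mod c. lin_map r c A v = 0} = lin_map c c' A' ` free_mod c'"
    for r c c' and A A' :: "nat \<Rightarrow> nat \<Rightarrow> ('n, 'k) mpoly"
  have good_ex: "\<exists>p. good r c A (fst p) (snd p)" for r c A
    using submod_eq_lin_image[of "{v \<in> free_mod c. lin_map r c A v = 0}" c, OF submod_kernel]
    by (auto simp: good_def)
  define nxt where "nxt s = (case s of (r, c, A) \<Rightarrow> (c, SOME p. good r c A (fst p) (snd p)))"
    for s :: "nat \<times> nat \<times> (nat \<Rightarrow> nat \<Rightarrow> ('n, 'k) mpoly)"
  define st where "st = rec_nat (1, c0, A0) (\<lambda>_. nxt)"
  have st: "st 0 = (1, c0, A0)" "st (Suc i) = nxt (st i)" for i by (simp_all add: st_def)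
  define b where "b i = fst (st i)" for i
  define D where "D i = snd (snd (st i))" for i
  have b_Suc: "b (Suc i) = fst (snd (st i))" for i
    by (simp add: b_def st nxt_def split: prod.split)
  have good: "good (b i) (b (Suc i)) (D i) (b (Suc (Suc i))) (D (Suc i))" for i
  proof -
    obtain r c A where s: "st i = (r, c, A)" by (metis prod_cases3)
    have "good r c A (fst (snd (st (Suc i)))) (snd (snd (st (Suc i))))"
      unfolding st(2) s nxt_def prod.case snd_conv by (rule someI_ex[OF good_ex])
    then show ?thesis unfolding b_Suc D_def using s by (simp add: b_def)
  qed
  define e where "e = (\<lambda>q::nat. I +>\<^bsub>mpoly_ring\<^esub> (1 :: ('n, 'k) mpoly))"
  have "free_resolution mpoly_ring (quotient_module mpoly_ring I) b D e"
  proof (subst free_resolution_iff[OF I, where E = "\<lambda>_. 1"], simp add: e_def, intro conjI allI)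
    have b0: "b 0 = 1" by (simp add: b_def st)
    fix a :: "('n, 'k) mpoly"
    show "\<exists>v\<in>free_mod (b 0). (\<Sum>q<b 0. v q * 1) - a \<in> I"
      using ideal_0[OF I] by (intro bexI[of _ "\<lambda>q. if q = 0 then a else 0"]) (auto simp: b0 free_mod_def)
    show "{v \<in> free_mod (b 0). (\<Sum>q<b 0. v q * 1) \<in> I} = lin_map (b 0) (b 1) (D 0) ` free_mod (b 1)"
    proof -
      have "{v \<in> free_mod (b 0). (\<Sum>q<b 0. v q * 1) \<in> I} = M" by (simp add: b0 M_def)
      moreover have "b 1 = c0" "D 0 = A0" using b_Suc[of 0] by (simp_all add: D_def st)
      ultimately show ?thesis using A0 b0 by simp
    qed
    fix i
    show "{v \<in> free_mod (b (Suc i)). lin_map (b i) (b (Suc i)) (D i) v = 0} =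
      lin_map (b (Suc i)) (b (Suc (Suc i))) (D (Suc i)) ` free_mod (b (Suc (Suc i)))"
      using good[of i] by (simp add: good_def)
  qed
  then show ?thesis by blast
qed

section \<open>Orders and constant terms of polynomials\<close>

lemma total_degree_add: "total_degree (a + b) = total_degree a + total_degree b"
  by (simp add: total_degree_def lookup_add sum.distrib)

lemma total_degree_0 [simp]: "total_degree 0 = 0"
  by (simp add: total_degree_def)

lemma total_degree_eq_0_iff: "total_degree a = 0 \<longleftrightarrow> a = 0"
  by (auto simp: total_degree_def intro!: poly_mapping_eqI)

text \<open>
Membership in the \<open>N\<close>-th power of the irrelevant ideal, expressed through the monomials of \<open>a\<close>.
\<close>

definition order_ge :: "nat \<Rightarrow> ('n::finite, 'k::field) mpoly \<Rightarrow> bool" where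
  "order_ge N a \<longleftrightarrow> (\<forall>e. Poly_Mapping.lookup a e \<noteq> 0 \<longrightarrow> N \<le> total_degree e)"

lemma order_ge_0 [simp]: "order_ge 0 a" by (simp add: order_ge_def)

lemma order_ge_zero [simp]: "order_ge N 0" by (simp add: order_ge_def)

lemma order_ge_add: "order_ge N a \<Longrightarrow> order_ge N b \<Longrightarrow> order_ge N (a + b)"
  by (auto simp: order_ge_def lookup_add) (metis add.right_neutral)

lemma order_ge_mult:
  assumes "order_ge N a" "order_ge M b"
  shows "order_ge (N + M) (a * b)"
  unfolding order_ge_def
proof (intro allI impI)
  fix e assume "Poly_Mapping.lookup (a * b) e \<noteq> 0"
  then have "e \<in> Poly_Mapping.keys (a * b)" by (simp add: in_keys_iff)
  then obtain m m' where "m \<in> Poly_Mapping.keys a" "m' \<in> Poly_Mapping.keys b" "e = m + m'"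
    using keys_mult by blast
  then show "N + M \<le> total_degree e"
    using assms by (auto simp: order_ge_def in_keys_iff total_degree_add intro: add_mono)
qed

text \<open>
Among the products of terms of \<open>a\<close> and \<open>b\<close>, a monomial of the lowest degree \<open>N\<close> can only arise
from a term of \<open>a\<close> of degree \<open>N\<close> and the constant term of \<open>b\<close>.
\<close>

lemma lookup_mult_lowest:
  assumes a: "order_ge N a" and e: "total_degree e = N"
  shows "Poly_Mapping.lookup (a * b) e = Poly_Mapping.lookup a e * Poly_Mapping.lookup b 0"
proof -
  have "Poly_Mapping.lookup (a * b) e = (\<Sum>m\<in>Poly_Mapping.keys a. \<Sum>m'\<in>Poly_Mapping.keys b.
      if m = e then if m' = 0 then Poly_Mapping.lookup a e * Poly_Mapping.lookup b 0 else 0 else 0)"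
    unfolding lookup_mult_keys
  proof (intro sum.cong refl)
    fix m m' assume m: "m \<in> Poly_Mapping.keys a"
    have "m = e \<and> m' = 0" if "m + m' = e"
    proof -
      have "N \<le> total_degree m" using m a by (simp add: order_ge_def in_keys_iff)
      then have "total_degree m' = 0" using that e by (auto simp: total_degree_add)
      then have "m' = 0" by (simp add: total_degree_eq_0_iff)
      then show ?thesis using that by simp
    qed
    then show "(if m + m' = e then Poly_Mapping.lookup a m * Poly_Mapping.lookup b m' else 0) =
        (if m = e then if m' = 0 then Poly_Mapping.lookup a e * Poly_Mapping.lookup b 0 else 0 else 0)"
      by auto
  qed
  also have "\<dots> = (\<Sum>m\<in>Poly_Mapping.keys a. if m = e then Poly_Mapping.lookup a e * Poly_Mapping.lookup b 0 else 0)"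
    by (intro sum.cong refl) (auto simp: in_keys_iff)
  also have "\<dots> = Poly_Mapping.lookup a e * Poly_Mapping.lookup b 0"
    by (simp add: in_keys_iff)
  finally show ?thesis .
qed

lemma order_ge_1_iff: "order_ge 1 a \<longleftrightarrow> residue_map a = 0"
  unfolding residue_map_def
proof
  assume "order_ge 1 a"
  then show "Poly_Mapping.lookup a 0 = 0" by (force simp: order_ge_def)
next
  assume a: "Poly_Mapping.lookup a 0 = 0"
  show "order_ge 1 a" unfolding order_ge_def
  proof (intro allI impI)
    fix e assume "Poly_Mapping.lookup a e \<noteq> 0"
    with a have "e \<noteq> 0" by auto
    then show "1 \<le> total_degree e" using total_degree_eq_0_iff[of e] by linarith
  qed
qed

lemma residue_map_mult: "residue_map (a * b) = residue_map a * residue_map b"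
  unfolding residue_map_def by (rule lookup_mult_lowest[of 0]) auto

lemma residue_map_add: "residue_map (a + b) = residue_map a + residue_map b"
  and residue_map_diff: "residue_map (a - b) = residue_map a - residue_map b"
  and residue_map_0: "residue_map 0 = 0"
  and residue_map_1: "residue_map 1 = 1"
  by (simp_all add: residue_map_def lookup_add lookup_minus)

lemma residue_map_sum: "residue_map (sum f A) = (\<Sum>i\<in>A. residue_map (f i))"
  by (simp add: residue_map_def lookup_sum)

definition const_poly :: "'k \<Rightarrow> ('n::finite, 'k::field) mpoly" where
  "const_poly c = Poly_Mapping.single 0 c"

lemma residue_map_const_poly [simp]: "residue_map (const_poly c) = c"
  by (simp add: residue_map_def const_poly_def)

lemma const_poly_mult: "const_poly (a * b) = const_poly a * const_poly b"
  and const_poly_1: "const_poly 1 = 1"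
  and const_poly_0: "const_poly 0 = 0"
  and const_poly_uminus: "const_poly (- a) = - const_poly a"
  by (simp_all add: const_poly_def mult_single single_uminus)

text \<open>
The reduction \<open>F \<rightarrow> F \<otimes> k\<close> of a free module.
\<close>

definition residue_vec :: "(nat \<Rightarrow> ('n::finite, 'k::field) mpoly) \<Rightarrow> nat \<Rightarrow> 'k" where
  "residue_vec v = (\<lambda>p. residue_map (v p))"

lemma residue_vec_add: "residue_vec (v + w) = residue_vec v + residue_vec w"
  and residue_vec_diff: "residue_vec (v - w) = residue_vec v - residue_vec w"
  and residue_vec_scale: "residue_vec (scale a v) = scale (residue_map a) (residue_vec v)"
  by (auto simp: residue_vec_def scale_def residue_map_add residue_map_diff residue_map_mult)

lemma residue_vec_sum: "residue_vec (sum f A) = (\<Sum>i\<in>A. residue_vec (f i))"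
  by (auto simp: residue_vec_def sum_fun_apply residue_map_sum)

lemma residue_vec_lin_map:
  "residue_vec (lin_map r c A v) = lin_map r c (\<lambda>p q. residue_map (A p q)) (residue_vec v)"
  by (auto simp: residue_vec_def lin_map_def residue_map_sum residue_map_mult residue_map_0)

lemma residue_vec_free: "v \<in> free_mod c \<Longrightarrow> residue_vec v \<in> free_mod c"
  by (auto simp: residue_vec_def free_mod_def residue_map_0)

lemma residue_vec_free_surj: "residue_vec ` free_mod c = free_mod c"
proof
  show "free_mod c \<subseteq> (residue_vec ` free_mod c :: (nat \<Rightarrow> 'a) set)"
  proof
    fix v :: "nat \<Rightarrow> 'a" assume "v \<in> free_mod c"
    then show "v \<in> residue_vec ` free_mod c"
      by (intro image_eqI[of _ _ "\<lambda>p. const_poly (v p)"]) (auto simp: residue_vec_def free_mod_def const_poly_0)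
  qed
qed (use residue_vec_free in blast)

section \<open>Linear algebra over the coefficient field\<close>

interpretation kvec: vector_space "scale :: 'k::field \<Rightarrow> (nat \<Rightarrow> 'k) \<Rightarrow> _"
  by unfold_locales (auto simp: scale_def algebra_simps)

lemma kdim_eq: "kdim V = kvec.dim V"
  by (simp add: kdim_def scale_def[abs_def])

lemma submod_iff_subspace: "submod V \<longleftrightarrow> kvec.subspace V"
  by (auto simp: submod_def kvec.subspace_def)

definition unit_vec :: "nat \<Rightarrow> nat \<Rightarrow> 'r::zero_neq_one" where
  "unit_vec q = (\<lambda>p. if p = q then 1 else 0)"

lemma free_mod_decomp:
  fixes v :: "nat \<Rightarrow> 'r::comm_ring_1"
  assumes "v \<in> free_mod c" shows "v = (\<Sum>q<c. scale (v q) (unit_vec q))"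
proof
  fix p
  have "(\<Sum>q<c. scale (v q) (unit_vec q)) p = (\<Sum>q<c. if q = p then v p else 0)"
    unfolding sum_fun_apply by (intro sum.cong) (auto simp: scale_def unit_vec_def)
  then show "v p = (\<Sum>q<c. scale (v q) (unit_vec q)) p"
    using assms by (auto simp: free_mod_def)
qed

lemma unit_vec_free: "q < c \<Longrightarrow> unit_vec q \<in> free_mod c"
  by (auto simp: unit_vec_def free_mod_def)

lemma kvec_free_span: "free_mod c \<subseteq> kvec.span (unit_vec ` {..<c})"
proof
  fix v :: "nat \<Rightarrow> 'a" assume v: "v \<in> free_mod c"
  have "(\<Sum>q<c. scale (v q) (unit_vec q)) \<in> kvec.span (unit_vec ` {..<c})"
    by (intro kvec.span_sum kvec.span_scale kvec.span_base) auto
  then show "v \<in> kvec.span (unit_vec ` {..<c})" by (subst free_mod_decomp[OF v])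
qed

lemma kvec_independent_finite:
  "kvec.independent B \<Longrightarrow> B \<subseteq> free_mod c \<Longrightarrow> finite B"
  using kvec.independent_span_bound[of "unit_vec ` {..<c}" B] kvec_free_span[of c] by auto

lemma kvec_finite_basis:
  fixes V :: "(nat \<Rightarrow> 'k::field) set"
  assumes "submod V" "V \<subseteq> free_mod c"
  obtains B where "finite B" "B \<subseteq> V" "kvec.independent B" "kvec.span B = V"
proof -
  obtain B where B: "B \<subseteq> V" "kvec.independent B" "V \<subseteq> kvec.span B"
    using kvec.maximal_independent_subset by blast
  moreover have "kvec.span B \<subseteq> V"
    using B(1) assms(1) by (intro kvec.span_minimal) (auto simp: submod_iff_subspace)
  ultimately show ?thesis using kvec_independent_finite[of B c] assms(2) that by blast
qed

text \<open>
The space of all sequences is infinite-dimensional, so finiteness of bases is taken from the ambient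
space \<open>free_mod c\<close>.
\<close>

lemma kdim_less:
  fixes V W :: "(nat \<Rightarrow> 'k::field) set"
  assumes V: "submod V" and W: "submod W" "W \<subseteq> free_mod c" and VW: "V \<subseteq> W" and z: "z \<in> W" "z \<notin> V"
  shows "kdim V < kdim W"
proof -
  obtain B where B: "finite B" "B \<subseteq> V" "kvec.independent B" "kvec.span B = V"
    using kvec_finite_basis[OF V] VW W(2) by blast
  have ind: "kvec.independent (insert z B)"
    using B z by (intro kvec.independent_insertI) auto
  have "insert z B \<subseteq> W" using B VW z by blast
  then obtain C where C: "insert z B \<subseteq> C" "C \<subseteq> W" "kvec.independent C" "W \<subseteq> kvec.span C"
    using kvec.maximal_independent_subset_extend[OF _ ind] by blast
  have "finite C" using kvec_independent_finite[OF C(3)] C(2) W(2) by blast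
  have "kdim V = card B"
    unfolding kdim_eq using B by (intro kvec.dim_unique) auto
  moreover have "kdim W = card C"
    unfolding kdim_eq using C by (intro kvec.dim_unique) auto
  moreover have "z \<notin> B" using B(2) z(2) by blast
  then have "card B < card (insert z B)" using B(1) by simp
  moreover have "card (insert z B) \<le> card C" using C \<open>finite C\<close> by (intro card_mono) auto
  ultimately show ?thesis by simp
qed

section \<open>Multiples by powers of the irrelevant ideal\<close>

text \<open>
The submodule \<open>\<nn>\<^sup>N M\<close>.  The scalar action \<open>act\<close> is a parameter because both ideals, with the
multiplication of polynomials, and submodules of free modules are considered.
\<close>

inductive_set irrelevant_power_times ::
  "(('n::finite, 'k::field) mpoly \<Rightarrow> 'm \<Rightarrow> 'm::comm_monoid_add) \<Rightarrow> nat \<Rightarrow> 'm set \<Rightarrow> 'm set"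
  for act N M where
    zero: "0 \<in> irrelevant_power_times act N M"
  | add: "order_ge N a \<Longrightarrow> m \<in> M \<Longrightarrow> x \<in> irrelevant_power_times act N M \<Longrightarrow>
      act a m + x \<in> irrelevant_power_times act N M"

lemma irrelevant_power_times_single:
  assumes "order_ge N a" "m \<in> M"
  shows "act a m \<in> irrelevant_power_times act N M"
  using irrelevant_power_times.add[OF assms irrelevant_power_times.zero] by simp

lemma irrelevant_power_times_plus:
  assumes "x \<in> irrelevant_power_times act N M" "y \<in> irrelevant_power_times act N M"
  shows "x + y \<in> irrelevant_power_times act N M"
  using assms by (induction rule: irrelevant_power_times.induct)
    (auto simp: add.assoc intro: irrelevant_power_times.add)

lemma irrelevant_power_times_sum:
  "(\<And>i. i \<in> A \<Longrightarrow> f i \<in> irrelevant_power_times act N M) \<Longrightarrow> sum f A \<in> irrelevant_power_times act N M"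
  by (induction A rule: infinite_finite_induct) (auto intro: irrelevant_power_times.zero irrelevant_power_times_plus)

lemma irrelevant_power_times_mult:
  assumes "x \<in> irrelevant_power_times act N M"
    and act: "\<And>a x y. act a (x + y) = act a x + act a y" "\<And>a. act a 0 = 0" "\<And>a b x. act a (act b x) = act (a * b) x"
    and c: "order_ge L c"
  shows "act c x \<in> irrelevant_power_times act (L + N) M"
  using assms(1)
proof induction
  case zero then show ?case by (simp add: act irrelevant_power_times.zero)
next
  case (add a m x)
  then show ?case unfolding act
    by (intro irrelevant_power_times.add order_ge_mult c)
qed

lemma scale_laws:
  "scale a (x + y) = scale a x + scale a (y :: nat \<Rightarrow> 'r::comm_ring_1)" "scale a (0 :: nat \<Rightarrow> 'r) = 0"
  "scale a (scale b x) = scale (a * b) (x :: nat \<Rightarrow> 'r)" "scale 1 x = x"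
  "scale a (x - y) = scale a x - scale a y" "scale (a + b) x = scale a x + scale b x"
  "scale 0 x = 0" "scale (- a) x = - scale a x"
  by (auto simp: scale_def algebra_simps)

lemma scale_sum: "scale a (sum f A) = (\<Sum>i\<in>A. scale a (f i :: nat \<Rightarrow> 'r::comm_ring_1))"
  by (auto simp: scale_def sum_fun_apply sum_distrib_left)

lemma order_ge_irrelevant_power_times:
  "x \<in> irrelevant_power_times scale N M \<Longrightarrow> order_ge N (x p)"
proof (induction rule: irrelevant_power_times.induct)
  case (add a m x)
  then show ?case using order_ge_mult[of N a 0 "m p"] by (simp add: scale_def order_ge_add)
qed simp

text \<open>
Elements \<open>\<mu> \<beta>\<close> of a free module with linearly independent constant terms \<open>\<beta>\<close> cannot have a
combination of higher order than its coefficients: if all coefficients have order at least \<open>q\<close>, then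
the part of degree \<open>q\<close> of the combination involves only the constant terms of the \<open>\<mu> \<beta>\<close>, and by
independence the parts of degree \<open>q\<close> of the coefficients vanish.
\<close>

lemma order_ge_coefficients:
  fixes \<mu> :: "(nat \<Rightarrow> 'k::field) \<Rightarrow> nat \<Rightarrow> ('n::finite, 'k) mpoly"
  assumes B: "finite B" "kvec.independent B"
    and \<mu>: "\<And>\<beta>. \<beta> \<in> B \<Longrightarrow> residue_vec (\<mu> \<beta>) = \<beta>"
    and N: "\<And>p. order_ge N ((\<Sum>\<beta>\<in>B. scale (a \<beta>) (\<mu> \<beta>)) p)"
    and \<beta>: "\<beta> \<in> B"
  shows "order_ge N (a \<beta>)"
proof -
  have "\<forall>\<beta>\<in>B. order_ge q (a \<beta>)" if "q \<le> N" for q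
    using that
  proof (induction q)
    case (Suc q)
    then have IH: "\<And>\<beta>. \<beta> \<in> B \<Longrightarrow> order_ge q (a \<beta>)" by simp
    have coeff: "Poly_Mapping.lookup (a \<beta>) e = 0" if e: "total_degree e = q" and "\<beta> \<in> B" for e \<beta>
    proof -
      have "(\<Sum>\<beta>\<in>B. scale (Poly_Mapping.lookup (a \<beta>) e) \<beta>) = 0"
      proof
        fix p
        have "(\<Sum>\<beta>\<in>B. scale (Poly_Mapping.lookup (a \<beta>) e) \<beta>) p = (\<Sum>\<beta>\<in>B. Poly_Mapping.lookup (a \<beta> * \<mu> \<beta> p) e)"
          unfolding sum_fun_apply
        proof (rule sum.cong[OF refl])
          fix \<beta> assume b: "\<beta> \<in> B"
          have "Poly_Mapping.lookup (\<mu> \<beta> p) 0 = \<beta> p"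
            using \<mu>[OF b] by (metis residue_vec_def residue_map_def)
          then show "scale (Poly_Mapping.lookup (a \<beta>) e) \<beta> p = Poly_Mapping.lookup (a \<beta> * \<mu> \<beta> p) e"
            using lookup_mult_lowest[OF IH[OF b] e] by (simp add: scale_def)
        qed
        also have "\<dots> = Poly_Mapping.lookup ((\<Sum>\<beta>\<in>B. scale (a \<beta>) (\<mu> \<beta>)) p) e"
          by (simp add: sum_fun_apply lookup_sum scale_def)
        also have "\<dots> = 0" using N[of p] e Suc.prems by (auto simp: order_ge_def)
        finally show "(\<Sum>\<beta>\<in>B. scale (Poly_Mapping.lookup (a \<beta>) e) \<beta>) p = 0 p" by simp
      qed
      from kvec.independentD[OF B(2) B(1) subset_refl this \<open>\<beta> \<in> B\<close>] show ?thesis .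
    qed
    show ?case
    proof
      fix \<beta> assume b: "\<beta> \<in> B"
      show "order_ge (Suc q) (a \<beta>)" unfolding order_ge_def
      proof (intro allI impI)
        fix e assume nz: "Poly_Mapping.lookup (a \<beta>) e \<noteq> 0"
        then have "q \<le> total_degree e" using IH[OF b] by (simp add: order_ge_def)
        moreover have "total_degree e \<noteq> q" using coeff[OF _ b] nz by blast
        ultimately show "Suc q \<le> total_degree e" by simp
      qed
    qed
  qed simp
  then show ?thesis using \<beta> by blast
qed

text \<open>
If elements of \<open>M\<close> without constant terms already lie in \<open>\<nn> M\<close>, then \<open>M\<close> is generated, up to arbitrarily
high powers of the irrelevant ideal, by lifts \<open>\<mu>\<close> of a basis of the space of its constant terms.
This takes the place of the Nakayama lemma for the localisation at the origin: a resolution need not be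
graded, so \<open>M\<close> need not be homogeneous.
\<close>

lemma expand_modulo_powers:
  fixes M :: "(nat \<Rightarrow> ('n::finite, 'k::field) mpoly) set"
  assumes M: "submod M"
    and \<mu>: "\<And>\<beta>. \<beta> \<in> B \<Longrightarrow> \<mu> \<beta> \<in> M" "\<And>\<beta>. \<beta> \<in> B \<Longrightarrow> residue_vec (\<mu> \<beta>) = \<beta>"
    and B: "finite B" "residue_vec ` M \<subseteq> kvec.span B"
    and deep: "\<And>m. m \<in> M \<Longrightarrow> residue_vec m = 0 \<Longrightarrow> m \<in> irrelevant_power_times scale 1 M"
    and x: "x \<in> M"
  shows "\<exists>c. x - (\<Sum>\<beta>\<in>B. scale (c \<beta>) (\<mu> \<beta>)) \<in> irrelevant_power_times scale N M"
proof -
  have first: "\<exists>c. m - (\<Sum>\<beta>\<in>B. scale (c \<beta>) (\<mu> \<beta>)) \<in> irrelevant_power_times scale 1 M" if m: "m \<in> M" for m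
  proof -
    have "residue_vec m \<in> kvec.span B" using B(2) m by blast
    then obtain r where r: "residue_vec m = (\<Sum>\<beta>\<in>B. scale (r \<beta>) \<beta>)"
      unfolding kvec.span_finite[OF B(1)] by auto
    let ?d = "m - (\<Sum>\<beta>\<in>B. scale (const_poly (r \<beta>)) (\<mu> \<beta>))"
    have "?d \<in> M" using M m \<mu>(1) by (intro submod_diff submod_sum submod_scale)
    moreover have "residue_vec ?d = 0"
      using \<mu>(2) by (simp add: residue_vec_diff residue_vec_sum residue_vec_scale r)
    ultimately have "?d \<in> irrelevant_power_times scale 1 M" by (rule deep)
    then show ?thesis by (intro exI)
  qed
  have step: "\<exists>c. y - (\<Sum>\<beta>\<in>B. scale (c \<beta>) (\<mu> \<beta>)) \<in> irrelevant_power_times scale (Suc N) M"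
    if "y \<in> irrelevant_power_times scale N M" for y N
    using that
  proof induction
    case zero
    have "0 - (\<Sum>\<beta>\<in>B. scale 0 (\<mu> \<beta>)) = 0" by (simp add: scale_laws)
    then show ?case using irrelevant_power_times.zero[of scale "Suc N" M] by (intro exI[of _ "\<lambda>_. 0"]) (simp only:)
  next
    case (add a m y)
    obtain c where c: "y - (\<Sum>\<beta>\<in>B. scale (c \<beta>) (\<mu> \<beta>)) \<in> irrelevant_power_times scale (Suc N) M"
      using add.IH by blast
    obtain d where d: "m - (\<Sum>\<beta>\<in>B. scale (d \<beta>) (\<mu> \<beta>)) \<in> irrelevant_power_times scale 1 M"
      using first add.hyps by blast
    have "scale a (m - (\<Sum>\<beta>\<in>B. scale (d \<beta>) (\<mu> \<beta>))) \<in> irrelevant_power_times scale (N + 1) M"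
      by (rule irrelevant_power_times_mult[OF d]) (auto simp: scale_laws add.hyps)
    from irrelevant_power_times_plus[OF this[simplified Suc_eq_plus1[symmetric]] c]
    have "scale a m + y - (\<Sum>\<beta>\<in>B. scale (a * d \<beta> + c \<beta>) (\<mu> \<beta>)) \<in> irrelevant_power_times scale (Suc N) M"
      by (simp add: scale_laws scale_sum sum.distrib algebra_simps)
    then show ?case by (rule exI[of _ "\<lambda>\<beta>. a * d \<beta> + c \<beta>"])
  qed
  show ?thesis
  proof (induction N)
    case 0
    have "scale 1 x \<in> irrelevant_power_times scale 0 M" using x by (intro irrelevant_power_times_single) auto
    moreover have "scale 1 x = x - (\<Sum>\<beta>\<in>B. scale 0 (\<mu> \<beta>))" by (simp add: scale_laws)
    ultimately show ?case by (intro exI[of _ "\<lambda>_. 0"]) (simp only:)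
  next
    case (Suc N)
    then obtain c where c: "x - (\<Sum>\<beta>\<in>B. scale (c \<beta>) (\<mu> \<beta>)) \<in> irrelevant_power_times scale N M" by blast
    from step[OF this] obtain d where
      "x - (\<Sum>\<beta>\<in>B. scale (c \<beta>) (\<mu> \<beta>)) - (\<Sum>\<beta>\<in>B. scale (d \<beta>) (\<mu> \<beta>)) \<in> irrelevant_power_times scale (Suc N) M"
      by blast
    then have "x - (\<Sum>\<beta>\<in>B. scale (c \<beta> + d \<beta>) (\<mu> \<beta>)) \<in> irrelevant_power_times scale (Suc N) M"
      by (simp add: scale_laws sum.distrib algebra_simps)
    then show ?case by (rule exI[of _ "\<lambda>\<beta>. c \<beta> + d \<beta>"])
  qed
qed

section \<open>Nonvanishing of Tor over the polynomial ring\<close>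

lemma lin_map_decomp:
  fixes A :: "nat \<Rightarrow> nat \<Rightarrow> 'r::comm_ring_1"
  assumes "v \<in> free_mod c"
  shows "lin_map r c A v = (\<Sum>q<c. scale (v q) (lin_map r c A (unit_vec q)))"
proof -
  have sum: "lin_map r c A (sum f B) = (\<Sum>i\<in>B. lin_map r c A (f i))" for f :: "nat \<Rightarrow> nat \<Rightarrow> 'r" and B
  proof
    fix p
    have "(\<Sum>q<c. \<Sum>i\<in>B. A p q * f i q) = (\<Sum>i\<in>B. \<Sum>q<c. A p q * f i q)" by (rule sum.swap)
    then show "lin_map r c A (sum f B) p = (\<Sum>i\<in>B. lin_map r c A (f i)) p"
      by (simp add: lin_map_def sum_fun_apply sum_distrib_left)
  qed
  show ?thesis
    by (subst free_mod_decomp[OF assms]) (simp add: sum lin_map_scale)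
qed

text \<open>
Let \<open>M\<close> be the kernel of \<open>F\<^sub>1 \<rightarrow> F\<^sub>0\<close>.  The composition \<open>\<psi>\<close> of \<open>F\<^sub>1 \<rightarrow> F\<^sub>0\<close> with the lifted
augmentation maps \<open>F\<^sub>1\<close> into \<open>I\<close>, sends \<open>\<nn> F\<^sub>1\<close> into \<open>\<nn> I\<close> and vanishes on \<open>M\<close>.  If \<open>wf\<close> and \<open>wg\<close>
are lifts of \<open>f u\<close> and \<open>g u\<close>, where \<open>u\<close> is mapped to \<open>1\<close> in the quotient, then \<open>\<psi>\<close> maps them to \<open>f\<close> and
\<open>g\<close> up to elements of \<open>\<nn> I\<close>.  Hence the constant terms of \<open>wf\<close> and \<open>wg\<close> are linearly independent
modulo those of \<open>M\<close>, and the boundaries in degree 1 are exactly the constant terms of \<open>M\<close>.  This gives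
the class of \<open>wf\<close> in degree 1.

Suppose that the homology in degree 2 is zero.  Then an element of \<open>M\<close> without constant terms lies
in \<open>\<nn> M\<close>, so the Koszul syzygy \<open>g wf - f wg \<in> M\<close> is, up to a high power of the irrelevant ideal, a
combination of lifts of a basis of the constant terms of \<open>M\<close>.  Together with \<open>wf\<close> and \<open>wg\<close>
these lifts have independent constant terms, so the coefficient \<open>g\<close> would have arbitrarily high order.
\<close>

lemma tor_nonzero:
  fixes I :: "('n::finite, 'k::field) mpoly set"
  defines "nI \<equiv> irrelevant_power_times (*) 1 I"
  assumes I: "ideal I mpoly_ring" and I0: "\<And>x. x \<in> I \<Longrightarrow> residue_map x = 0"
    and f: "f \<in> I" "f \<notin> nI" and g: "g \<in> I" "\<And>c. g - const_poly c * f \<notin> nI"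
    and res: "free_resolution mpoly_ring (quotient_module mpoly_ring I) b D e"
  shows "\<not> cycles (field_module residue_map) b D 1 \<subseteq> boundaries (field_module residue_map) b D 1"
    and "\<not> cycles (field_module residue_map) b D 2 \<subseteq> boundaries (field_module residue_map) b D 2"
proof -
  obtain E where E: "\<And>q. q < b 0 \<Longrightarrow> e q = I +>\<^bsub>mpoly_ring\<^esub> E q"
    using free_resolution_representatives[OF res I] by blast
  define aug where "aug v = (\<Sum>q<b 0. v q * E q)" for v :: "nat \<Rightarrow> ('n, 'k) mpoly"
  define L where "L i = lin_map (b i) (b (Suc i)) (D i)" for i
  define F where "F i = (free_mod (b i) :: (nat \<Rightarrow> ('n, 'k) mpoly) set)" for i
  have surj: "\<And>a. \<exists>v\<in>F 0. aug v - a \<in> I"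
    and ex0: "{v \<in> F 0. aug v \<in> I} = L 0 ` F 1"
    and ex: "\<And>i. {v \<in> F (Suc i). L i v = 0} = L (Suc i) ` F (Suc (Suc i))"
    using iffD1[OF free_resolution_iff[OF I, where b = b and e = e and E = E and D = D] res] E
    by (simp_all add: aug_def L_def F_def)
  have aug_add: "aug (v + w) = aug v + aug w" and aug_scale: "aug (scale a v) = a * aug v" for v w a
    by (simp_all add: aug_def scale_def algebra_simps sum.distrib sum_distrib_left)
  have aug_sum: "aug (sum h A) = (\<Sum>i\<in>A. aug (h i))" for h :: "nat \<Rightarrow> _" and A
    by (simp add: aug_def sum_fun_apply sum_distrib_right sum.swap[of _ A])
  have L_add: "L i (v + w) = L i v + L i w" and L_diff: "L i (v - w) = L i v - L i w"
    and L_scale: "L i (scale a v) = scale a (L i v)" for i v w a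
    by (simp_all add: L_def lin_map_add lin_map_diff lin_map_scale)
  have L_decomp: "L i v = (\<Sum>q<b (Suc i). scale (v q) (L i (unit_vec q)))" if "v \<in> F (Suc i)" for i v
    using lin_map_decomp[of v "b (Suc i)" "b i" "D i"] that by (simp add: L_def F_def)
  have F: "submod (F i)" for i unfolding F_def by (rule submod_free)
  have unit: "unit_vec q \<in> F i" if "q < b i" for q i using unit_vec_free[OF that] by (simp add: F_def)
  obtain u where u: "u \<in> F 0" "aug u - 1 \<in> I" using surj by blast
  \<comment> \<open>\<open>aug\<close> takes the value 1 only modulo \<open>I\<close>; the error \<open>h\<close> is harmless because \<open>h * I\<close> lies in \<open>nI\<close>.\<close>
  define h where "h = aug u - 1"
  have h: "h \<in> I" "aug u = 1 + h" using u by (simp_all add: h_def)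
  have lift: "\<exists>w\<in>F 1. L 0 w = scale x u" if "x \<in> I" for x
  proof -
    have "scale x u \<in> F 0" using u F by (intro submod_scale)
    moreover have "aug (scale x u) \<in> I"
      unfolding aug_scale using ideal_mult[OF I that, of "aug u"] by (simp add: mult.commute)
    ultimately have "scale x u \<in> L 0 ` F 1" using ex0 by blast
    then show ?thesis by force
  qed
  obtain wf where wf: "wf \<in> F 1" "L 0 wf = scale f u" using lift[OF f(1)] by blast
  obtain wg where wg: "wg \<in> F 1" "L 0 wg = scale g u" using lift[OF g(1)] by blast
  define M where "M = {v \<in> F 1. L 0 v = 0}"
  have M: "M = L 1 ` F 2" using ex[of 0] by (simp add: M_def numeral_2_eq_2)
  have M_sub: "submod M" unfolding M_def F_def L_def using submod_kernel by simp
  define \<psi> where "\<psi> w = aug (L 0 w)" for w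
  have psi_I: "\<psi> w \<in> I" if "w \<in> F 1" for w using ex0 that by (auto simp: \<psi>_def)
  have nI_mult: "c * x \<in> nI" if "x \<in> nI" for c x
    using irrelevant_power_times_mult[of x "(*)" 1 I 0 c] that by (simp add: nI_def algebra_simps)
  have nI_add: "x + y \<in> nI" if "x \<in> nI" "y \<in> nI" for x y
    using that irrelevant_power_times_plus unfolding nI_def by blast
  have psi_nI: "\<psi> w \<in> nI" if w: "w \<in> F 1" "residue_vec w = 0" for w
  proof -
    have "\<psi> w = (\<Sum>q<b 1. w q * \<psi> (unit_vec q))"
      using L_decomp[of w 0] w by (simp add: \<psi>_def aug_sum aug_scale)
    also have "\<dots> \<in> nI" unfolding nI_def
    proof (intro irrelevant_power_times_sum irrelevant_power_times_single)
      fix q assume "q \<in> {..<b 1}"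
      then show "\<psi> (unit_vec q) \<in> I" using unit by (intro psi_I) auto
      have "residue_map (w q) = 0" using fun_cong[OF w(2), of q] by (simp add: residue_vec_def)
      then show "order_ge 1 (w q)" by (simp only: order_ge_1_iff)
    qed
    finally show ?thesis .
  qed
  \<comment> \<open>A relation between the constant terms lifts to an element of \<open>\<nn> F\<^sub>1\<close>, to which \<open>psi_nI\<close> applies.\<close>
  have indep: "\<alpha> = 0 \<and> \<gamma> = 0"
    if M': "scale \<alpha> (residue_vec wf) + scale \<gamma> (residue_vec wg) \<in> residue_vec ` M" for \<alpha> \<gamma> :: 'k
  proof -
    obtain m where m: "m \<in> M" "scale \<alpha> (residue_vec wf) + scale \<gamma> (residue_vec wg) = residue_vec m"
      using M' by force
    define w where "w = scale (const_poly \<alpha>) wf + scale (const_poly \<gamma>) wg - m"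
    have "w \<in> F 1" unfolding w_def using wf wg m F M_def
      by (intro submod_diff submod_add submod_scale) auto
    moreover have "residue_vec w = 0"
      by (simp add: w_def residue_vec_diff residue_vec_add residue_vec_scale m)
    ultimately have "\<psi> w \<in> nI" by (rule psi_nI)
    have "L 0 m = 0" using m(1) by (simp add: M_def)
    then have "L 0 w = scale (const_poly \<alpha>) (scale f u) + scale (const_poly \<gamma>) (scale g u)"
      by (simp add: w_def L_diff L_add L_scale wf wg)
    then have "\<psi> w = (const_poly \<alpha> * f + const_poly \<gamma> * g) * aug u"
      by (simp add: \<psi>_def aug_add aug_scale algebra_simps)
    also have "\<dots> = (const_poly \<alpha> * f + const_poly \<gamma> * g) + h * (const_poly \<alpha> * f + const_poly \<gamma> * g)"
      by (simp add: h(2) algebra_simps)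
    finally have eq: "const_poly \<alpha> * f + const_poly \<gamma> * g = \<psi> w + (- 1) * (h * (const_poly \<alpha> * f + const_poly \<gamma> * g))" by simp
    have "h * (const_poly \<alpha> * f + const_poly \<gamma> * g) \<in> nI"
      unfolding nI_def
    proof (rule irrelevant_power_times_single)
      show "order_ge 1 h" using I0[OF h(1)] by (simp only: order_ge_1_iff)
      show "const_poly \<alpha> * f + const_poly \<gamma> * g \<in> I" using f g by (intro ideal_add[OF I] ideal_mult[OF I])
    qed
    from nI_add[OF \<open>\<psi> w \<in> nI\<close> nI_mult[OF this, of "- 1"]]
    have comb: "const_poly \<alpha> * f + const_poly \<gamma> * g \<in> nI"
      by (simp only: eq[symmetric])
    have "\<gamma> = 0"
    proof (rule ccontr)
      assume "\<gamma> \<noteq> 0"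
      then have inv: "const_poly (inverse \<gamma>) * const_poly \<gamma> = (1 :: ('n, 'k) mpoly)"
        by (simp flip: const_poly_mult add: const_poly_1)
      have "const_poly (inverse \<gamma>) * (const_poly \<alpha> * f + const_poly \<gamma> * g) = const_poly (inverse \<gamma>) * const_poly \<gamma> * g - const_poly (- (inverse \<gamma> * \<alpha>)) * f"
        by (simp add: algebra_simps const_poly_mult const_poly_uminus)
      then have "g - const_poly (- (inverse \<gamma> * \<alpha>)) * f \<in> nI"
        using nI_mult[OF comb, of "const_poly (inverse \<gamma>)"] by (simp add: inv)
      then show False using g(2) by blast
    qed
    moreover have "\<alpha> = 0"
    proof (rule ccontr)
      assume "\<alpha> \<noteq> 0"
      then have inv: "const_poly (inverse \<alpha>) * const_poly \<alpha> = (1 :: ('n, 'k) mpoly)"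
        by (simp flip: const_poly_mult add: const_poly_1)
      have "const_poly (inverse \<alpha>) * (const_poly \<alpha> * f) \<in> nI"
        using comb \<open>\<gamma> = 0\<close> by (intro nI_mult[of "const_poly \<alpha> * f"]) (simp add: const_poly_0)
      then show False using f(2) by (simp flip: mult.assoc add: inv)
    qed
    ultimately show ?thesis by simp
  qed
  let ?C = "cycles (field_module (residue_map :: ('n, 'k) mpoly \<Rightarrow> 'k)) b D"
  let ?B = "boundaries (field_module (residue_map :: ('n, 'k) mpoly \<Rightarrow> 'k)) b D"
  have cyc: "residue_vec y \<in> ?C (Suc i)" if "y \<in> F (Suc i)" "residue_vec (L i y) = 0" for y i
  proof -
    have "lin_map (b i) (b (Suc i)) (\<lambda>p q. residue_map (D i p q)) (residue_vec y) = 0"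
      using that(2) by (simp add: L_def residue_vec_lin_map)
    then show ?thesis
      using residue_vec_free that(1)
      by (simp add: cycles_def dsum_field mat_act_field F_def zero_fun_def) (simp add: field_module_def)
  qed
  have bnd: "?B i = residue_vec ` L i ` F (Suc i)" for i
  proof -
    have "?B i = lin_map (b i) (b (Suc i)) (\<lambda>p q. residue_map (D i p q)) ` free_mod (b (Suc i))"
      unfolding boundaries_def dsum_field mat_act_field ..
    also have "\<dots> = lin_map (b i) (b (Suc i)) (\<lambda>p q. residue_map (D i p q)) ` residue_vec ` F (Suc i)"
      by (simp only: residue_vec_free_surj F_def)
    also have "\<dots> = residue_vec ` L i ` F (Suc i)"
      by (simp add: image_image L_def residue_vec_lin_map)
    finally show ?thesis .
  qed
  have f0: "residue_map f = 0" "residue_map g = 0" using I0 f g by auto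
  show "\<not> ?C 1 \<subseteq> ?B 1"
  proof
    assume sub: "?C 1 \<subseteq> ?B 1"
    have "residue_vec wf \<in> ?C 1"
      using cyc[of wf 0] wf f0 by (simp add: residue_vec_scale scale_laws)
    then have "residue_vec wf \<in> residue_vec ` M" using sub bnd[of 1] M by (auto simp: numeral_2_eq_2)
    then have "scale 1 (residue_vec wf) + scale 0 (residue_vec wg) \<in> residue_vec ` M"
      by (simp add: scale_laws)
    from indep[OF this] show False by simp
  qed
  show "\<not> ?C 2 \<subseteq> ?B 2"
  proof
    assume sub: "?C 2 \<subseteq> ?B 2"
    have deep: "m \<in> irrelevant_power_times scale 1 M" if m: "m \<in> M" "residue_vec m = 0" for m
    proof -
      obtain y where y: "y \<in> F 2" "m = L 1 y" using m(1) M by blast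
      then have "residue_vec y \<in> ?C 2" using cyc[of y 1] m(2) by (simp add: numeral_2_eq_2)
      then obtain x where x: "x \<in> F 3" "residue_vec y = residue_vec (L 2 x)"
        using sub bnd[of 2] by (auto simp: numeral_3_eq_3 numeral_2_eq_2)
      define y' where "y' = y - L 2 x"
      have "L 2 x \<in> {v \<in> F 2. L 1 v = 0}"
        using ex[of 1] x(1) by (simp add: numeral_2_eq_2 numeral_3_eq_3)
      then have y': "y' \<in> F 2" "L 1 y' = m" "residue_vec y' = 0"
        using y x by (auto simp: y'_def L_diff residue_vec_diff intro!: submod_diff F)
      have "m = (\<Sum>q<b 2. scale (y' q) (L 1 (unit_vec q)))"
        using L_decomp[of y' 1] y' by (simp add: numeral_2_eq_2)
      also have "\<dots> \<in> irrelevant_power_times scale 1 M"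
      proof (intro irrelevant_power_times_sum irrelevant_power_times_single)
        fix q assume "q \<in> {..<b 2}"
        then show "L 1 (unit_vec q) \<in> M" using unit M by auto
        have "residue_map (y' q) = 0" using fun_cong[OF y'(3), of q] by (simp add: residue_vec_def)
        then show "order_ge 1 (y' q)" by (simp only: order_ge_1_iff)
      qed
      finally show ?thesis .
    qed
    have M_res: "submod (residue_vec ` M)"
      unfolding submod_def
    proof (intro conjI ballI allI)
      show "0 \<in> residue_vec ` M"
        using submod_0[OF M_sub] by (intro image_eqI[of _ _ 0]) (auto simp: residue_vec_def residue_map_0)
      fix x assume x: "x \<in> residue_vec ` M"
      then show "x + y \<in> residue_vec ` M" if "y \<in> residue_vec ` M" for y
        using that M_sub by (auto simp: submod_add simp flip: residue_vec_add)
      show "scale a x \<in> residue_vec ` M" for a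
      proof -
        obtain m where "m \<in> M" "x = residue_vec m" using x by blast
        then show ?thesis
          using M_sub by (intro image_eqI[of _ _ "scale (const_poly a) m"]) (auto simp: residue_vec_scale submod_scale)
      qed
    qed
    have "residue_vec ` M \<subseteq> free_mod (b 1)"
      using residue_vec_free by (auto simp: M_def F_def)
    from kvec_finite_basis[OF M_res this] obtain B where
      B: "finite B" "B \<subseteq> residue_vec ` M" "kvec.independent B" "kvec.span B = residue_vec ` M" by blast
    let ?f = "residue_vec wf" and ?g = "residue_vec wg"
    have g_span: "?g \<notin> kvec.span B"
    proof
      assume "?g \<in> kvec.span B"
      then have "scale 0 ?f + scale 1 ?g \<in> residue_vec ` M" using B(4) by (simp add: scale_laws)
      from indep[OF this] show False by simp
    qed
    have f_span: "?f \<notin> kvec.span (insert ?g B)"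
    proof
      assume "?f \<in> kvec.span (insert ?g B)"
      then obtain k where "?f - scale k ?g \<in> kvec.span B" using kvec.span_insert[of ?g B] by blast
      then have "scale 1 ?f + scale (- k) ?g \<in> residue_vec ` M" using B(4) by (simp add: scale_laws)
      from indep[OF this] show False by simp
    qed
    let ?B' = "insert ?f (insert ?g B)"
    have B': "kvec.independent ?B'" "finite ?B'"
      using kvec.independent_insertI[OF f_span kvec.independent_insertI[OF g_span B(3)]] B(1) by auto
    have neq: "?f \<noteq> ?g" "?f \<notin> B" "?g \<notin> B"
      using f_span g_span kvec.span_base by blast+
    have "\<forall>\<beta>. \<exists>m. \<beta> \<in> B \<longrightarrow> m \<in> M \<and> residue_vec m = \<beta>" using B(2) by blast
    from choice[OF this] obtain \<mu> where
      \<mu>: "\<And>\<beta>. \<beta> \<in> B \<Longrightarrow> \<mu> \<beta> \<in> M" "\<And>\<beta>. \<beta> \<in> B \<Longrightarrow> residue_vec (\<mu> \<beta>) = \<beta>" by blast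
    have "g \<noteq> 0" using g(2)[of 0] irrelevant_power_times.zero by (auto simp: nI_def const_poly_0)
    then obtain e0 where e0: "Poly_Mapping.lookup g e0 \<noteq> 0"
      by (metis lookup_zero poly_mapping_eqI)
    \<comment> \<open>\<open>g\<close> has a term of degree below \<open>N\<close>.\<close>
    define N where "N = Suc (total_degree e0)"
    define x where "x = scale g wf - scale f wg"
    have "x \<in> F 1" unfolding x_def using wf wg F by (intro submod_diff submod_scale) auto
    moreover have "L 0 x = 0"
      by (simp add: x_def L_diff L_scale wf wg scale_laws mult.commute)
    ultimately have "x \<in> M" by (simp add: M_def)
    have "\<exists>c. x - (\<Sum>\<beta>\<in>B. scale (c \<beta>) (\<mu> \<beta>)) \<in> irrelevant_power_times scale N M"
      by (rule expand_modulo_powers[OF M_sub \<mu> B(1) _ deep \<open>x \<in> M\<close>]) (use B(4) in auto)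
    then obtain c where c: "x - (\<Sum>\<beta>\<in>B. scale (c \<beta>) (\<mu> \<beta>)) \<in> irrelevant_power_times scale N M" by blast
    \<comment> \<open>The family of lifts extended by \<open>wf\<close> and \<open>wg\<close>, indexed by their constant terms.\<close>
    define \<mu>' where "\<mu>' = \<mu>(?f := wf, ?g := wg)"
    define a where "a = (\<lambda>\<beta>. - c \<beta>)(?f := g, ?g := - f)"
    have "(\<Sum>\<beta>\<in>?B'. scale (a \<beta>) (\<mu>' \<beta>)) = scale g wf + (- scale f wg + (\<Sum>\<beta>\<in>B. scale (a \<beta>) (\<mu>' \<beta>)))"
      using neq B(1) by (simp add: a_def \<mu>'_def scale_laws)
    also have "(\<Sum>\<beta>\<in>B. scale (a \<beta>) (\<mu>' \<beta>)) = - (\<Sum>\<beta>\<in>B. scale (c \<beta>) (\<mu> \<beta>))"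
      unfolding sum_negf[symmetric] using neq
      by (intro sum.cong) (auto simp: a_def \<mu>'_def scale_laws)
    finally have sum_eq: "(\<Sum>\<beta>\<in>?B'. scale (a \<beta>) (\<mu>' \<beta>)) = x - (\<Sum>\<beta>\<in>B. scale (c \<beta>) (\<mu> \<beta>))"
      by (simp add: x_def fun_eq_iff)
    have "order_ge N (a ?f)"
    proof (rule order_ge_coefficients[OF B'(2,1)])
      show "residue_vec (\<mu>' \<beta>) = \<beta>" if "\<beta> \<in> ?B'" for \<beta> using that \<mu>(2) by (auto simp: \<mu>'_def)
      show "order_ge N ((\<Sum>\<beta>\<in>?B'. scale (a \<beta>) (\<mu>' \<beta>)) p)" for p
        unfolding sum_eq by (rule order_ge_irrelevant_power_times[OF c])
    qed simp
    then have "order_ge N g" using neq by (simp add: a_def)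
    then show False using e0 by (auto simp: order_ge_def N_def)
  qed
qed

section \<open>Homogeneous ideals\<close>

lemma lookup_hom_component:
  "Poly_Mapping.lookup (hom_component d f) e = (if total_degree e = d then Poly_Mapping.lookup f e else 0)"
proof -
  let ?K = "{m \<in> Poly_Mapping.keys f. total_degree m = d}"
  have "Poly_Mapping.lookup (hom_component d f) e = (\<Sum>m\<in>?K. if m = e then Poly_Mapping.lookup f e else 0)"
    unfolding hom_component_def lookup_sum lookup_single by (intro sum.cong) (auto simp: when_def)
  also have "\<dots> = (if total_degree e = d then Poly_Mapping.lookup f e else 0)"
    by (auto simp: in_keys_iff)
  finally show ?thesis .
qed

lemma hom_component_add: "hom_component d (f + g) = hom_component d f + hom_component d g"
  by (intro poly_mapping_eqI) (simp add: lookup_hom_component lookup_add)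

lemma hom_component_0 [simp]: "hom_component d 0 = 0"
  by (intro poly_mapping_eqI) (simp add: lookup_hom_component)

lemma hom_component_sum: "hom_component d (sum f A) = (\<Sum>i\<in>A. hom_component d (f i))"
  by (induction A rule: infinite_finite_induct) (auto simp: hom_component_add)

lemma hom_component_hom_component:
  "hom_component d (hom_component d' f) = (if d = d' then hom_component d f else 0)"
  by (intro poly_mapping_eqI) (simp add: lookup_hom_component)

lemma sum_hom_components:
  "(\<Sum>d\<in>total_degree ` Poly_Mapping.keys f. hom_component d f) = f"
  by (intro poly_mapping_eqI) (auto simp: lookup_sum lookup_hom_component in_keys_iff image_iff)

lemma hom_component_single_times:
  "hom_component d (Poly_Mapping.single s c * g) =
    (if total_degree s \<le> d then Poly_Mapping.single s c * hom_component (d - total_degree s) g else 0)"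
proof (rule poly_mapping_eqI)
  fix e
  show "Poly_Mapping.lookup (hom_component d (Poly_Mapping.single s c * g)) e =
    Poly_Mapping.lookup (if total_degree s \<le> d then Poly_Mapping.single s c * hom_component (d - total_degree s) g else 0) e"
  proof (cases "\<exists>x. e = s + x")
    case True
    then obtain x where "e = s + x" by blast
    then show ?thesis by (auto simp: lookup_hom_component lookup_single_times total_degree_add)
  next
    case False
    then have "Poly_Mapping.lookup (Poly_Mapping.single s c * h) e = 0" for h
      using lookup_single_times_neq_0 by blast
    then show ?thesis by (simp add: lookup_hom_component)
  qed
qed

lemma principalideal_if_dvd:
  fixes I :: "'r::comm_ring_1 set"
  assumes I: "ideal I ring_of_type_algebra" and f: "f \<in> I" and dvd: "\<And>g. g \<in> I \<Longrightarrow> f dvd g"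
  shows "principalideal I ring_of_type_algebra"
proof (rule principalidealI[OF I])
  have "I = genideal ring_of_type_algebra {f}"
  proof
    show "I \<subseteq> genideal ring_of_type_algebra {f}"
    proof
      fix g assume "g \<in> I"
      then obtain a where "g = a * f" using dvd by (metis dvd_def mult.commute)
      then show "g \<in> genideal ring_of_type_algebra {f}"
        by (auto simp: genideal_def intro: ideal_mult)
    qed
    show "genideal ring_of_type_algebra {f} \<subseteq> I"
      using I f by (auto simp: genideal_def)
  qed
  then show "\<exists>i\<in>carrier ring_of_type_algebra. I = genideal ring_of_type_algebra {i}" by auto
qed

text \<open>
A nonzero form of the smallest degree that occurs in \<open>I\<close>.
\<close>

lemma lowest_form_exists:
  fixes I :: "('n::finite, 'k::field) mpoly set"
  assumes I: "homogeneous_ideal I" and "\<not> principalideal I mpoly_ring"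
  obtains f d where "f \<in> I" "f \<noteq> 0" "hom_component d f = f" "\<And>g. g \<in> I \<Longrightarrow> order_ge d g"
proof -
  have ideal: "ideal I mpoly_ring" using I by (simp add: homogeneous_ideal_def)
  have deg: "hom_component (total_degree e) g \<noteq> 0" if "Poly_Mapping.lookup g e \<noteq> 0" for g :: "('n, 'k) mpoly" and e
    using that lookup_hom_component[of "total_degree e" g e] by auto
  have "\<exists>h\<in>I. h \<noteq> 0"
  proof (rule ccontr)
    assume "\<not> ?thesis"
    then have "principalideal I mpoly_ring"
      by (intro principalideal_if_dvd[OF ideal ideal_0[OF ideal]]) auto
    with assms show False by simp
  qed
  then obtain h e where "h \<in> I" "Poly_Mapping.lookup h e \<noteq> 0"
    by (metis lookup_zero poly_mapping_eqI)
  then have ex: "\<exists>d. \<exists>h\<in>I. hom_component d h \<noteq> 0" using deg by blast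
  define d where "d = (LEAST d. \<exists>h\<in>I. hom_component d h \<noteq> 0)"
  obtain h' where h': "h' \<in> I" "hom_component d h' \<noteq> 0"
    using LeastI_ex[OF ex] unfolding d_def by blast
  show thesis
  proof (rule that[of "hom_component d h'" d])
    show "hom_component d h' \<in> I" using I h' by (simp add: homogeneous_ideal_def)
    show "hom_component d (hom_component d h') = hom_component d h'"
      by (simp add: hom_component_hom_component)
    show "order_ge d g" if "g \<in> I" for g
      unfolding order_ge_def d_def using that deg by (blast intro: Least_le)
  qed (rule h')
qed

text \<open>
Graded Nakayama lemma.  Take for \<open>f\<close> a form of the lowest degree \<open>d\<close> in \<open>I\<close>; it is not in \<open>\<nn> I\<close>, whose
elements have order at least \<open>d + 1\<close>.  If \<open>f\<close> spanned \<open>I\<close> modulo \<open>\<nn> I\<close>, then it would divide all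
components of all elements of \<open>I\<close>, by induction on the degree: a component of an element of \<open>\<nn> I\<close> is a
combination of components of lower degree of elements of \<open>I\<close>.
\<close>

lemma independent_generators_exist:
  fixes I :: "('n::finite, 'k::field) mpoly set"
  assumes I: "homogeneous_ideal I" and np: "\<not> principalideal I mpoly_ring"
  obtains f g where "f \<in> I" "f \<notin> irrelevant_power_times (*) 1 I"
    "g \<in> I" "\<And>c. g - const_poly c * f \<notin> irrelevant_power_times (*) 1 I"
proof -
  have ideal: "ideal I mpoly_ring" using I by (simp add: homogeneous_ideal_def)
  let ?nI = "irrelevant_power_times (*) 1 I"
  obtain f d where f: "f \<in> I" "f \<noteq> 0" "hom_component d f = f" and d: "\<And>g. g \<in> I \<Longrightarrow> order_ge d g"
    using lowest_form_exists[OF I np] by blast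
  have nI_order: "order_ge (Suc d) x" if "x \<in> ?nI" for x
    using that
  proof induction
    case (add a m x)
    then show ?case using order_ge_mult[OF add.hyps(1) d[OF add.hyps(2)]] by (simp add: order_ge_add)
  qed simp
  have f_nI: "f \<notin> ?nI"
  proof
    assume "f \<in> ?nI"
    then have "order_ge (Suc d) f" by (rule nI_order)
    then have "hom_component d f = 0"
      by (intro poly_mapping_eqI) (auto simp: lookup_hom_component order_ge_def)
    then show False using f by simp
  qed
  have "\<exists>g\<in>I. \<forall>c. g - const_poly c * f \<notin> ?nI"
  proof (rule ccontr)
    assume "\<not> ?thesis"
    then have gen: "\<And>g. g \<in> I \<Longrightarrow> \<exists>c. g - const_poly c * f \<in> ?nI" by blast
    have "f dvd hom_component m g" if "g \<in> I" for m g
      using that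
    proof (induction m arbitrary: g rule: less_induct)
      case (less m)
      have nI_dvd: "f dvd hom_component m x" if "x \<in> ?nI" for x
        using that
      proof induction
        case (add a y x)
        have "f dvd hom_component m (Poly_Mapping.single s (Poly_Mapping.lookup a s) * y)"
          if "s \<in> Poly_Mapping.keys a" for s
        proof -
          have "1 \<le> total_degree s" using that add.hyps(1) by (simp add: order_ge_def in_keys_iff)
          then show ?thesis
            using less.IH[of "m - total_degree s" y] add.hyps(2) by (auto simp: hom_component_single_times)
        qed
        moreover have "a * y = (\<Sum>s\<in>Poly_Mapping.keys a. Poly_Mapping.single s (Poly_Mapping.lookup a s) * y)"
          by (simp add: sum_monomials flip: sum_distrib_right)
        ultimately have "f dvd hom_component m (a * y)"
          by (simp add: hom_component_sum dvd_sum)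
        then show ?case using add.IH by (simp add: hom_component_add)
      qed simp
      obtain c where c: "g - const_poly c * f \<in> ?nI" using gen less.prems by blast
      have "hom_component m (const_poly c * f) = const_poly c * hom_component m f"
        by (simp add: const_poly_def hom_component_single_times)
      also have "f dvd \<dots>"
        by (subst f(3)[symmetric], subst hom_component_hom_component) (auto simp: f(3))
      finally have "f dvd hom_component m (g - const_poly c * f) + hom_component m (const_poly c * f)"
        using nI_dvd[OF c] by (intro dvd_add)
      then show ?case by (simp flip: hom_component_add)
    qed
    then have "f dvd g" if "g \<in> I" for g
      using that by (subst sum_hom_components[of g, symmetric]) (intro dvd_sum)
    then show False using principalideal_if_dvd[OF ideal f(1)] np by blast
  qed
  then show thesis using that f f_nI by blast
qed

text \<open>
In one variable a form is a monomial up to a scalar, and the one of lowest degree divides all others.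
\<close>

lemma card_variables_ge_2:
  fixes I :: "('n::finite, 'k::field) mpoly set"
  assumes I: "homogeneous_ideal I" and np: "\<not> principalideal I mpoly_ring"
  shows "CARD('n) \<ge> 2"
proof (rule ccontr)
  assume "\<not> CARD('n) \<ge> 2"
  moreover have "CARD('n) \<noteq> 0" by simp
  ultimately have "CARD('n) = 1" by linarith
  then obtain j where j: "(UNIV :: 'n set) = {j}" by (meson card_1_singletonE)
  have inj: "m = m'" if "total_degree m = total_degree m'" for m m' :: "'n \<Rightarrow>\<^sub>0 nat"
  proof (rule poly_mapping_eqI)
    fix i
    have "i = j" using j by auto
    then show "Poly_Mapping.lookup m i = Poly_Mapping.lookup m' i"
      using that by (simp add: total_degree_def j)
  qed
  have ideal: "ideal I mpoly_ring" using I by (simp add: homogeneous_ideal_def)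
  obtain f d where f: "f \<in> I" "f \<noteq> 0" "hom_component d f = f" and d: "\<And>g. g \<in> I \<Longrightarrow> order_ge d g"
    using lowest_form_exists[OF I np] by blast
  obtain m where m: "Poly_Mapping.lookup f m \<noteq> 0" using f(2) by (metis lookup_zero poly_mapping_eqI)
  then have deg_m: "total_degree m = d" using lookup_hom_component[of d f m] f(3) by (auto split: if_splits)
  have f_single: "f = Poly_Mapping.single m (Poly_Mapping.lookup f m)"
  proof (rule poly_mapping_eqI)
    fix e
    show "Poly_Mapping.lookup f e = Poly_Mapping.lookup (Poly_Mapping.single m (Poly_Mapping.lookup f m)) e"
      using lookup_hom_component[of d f e] f(3) inj[of e m] deg_m
      by (auto simp: lookup_single when_def split: if_splits)
  qed
  have "f dvd g" if g: "g \<in> I" for g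
  proof -
    have "f dvd Poly_Mapping.single e (Poly_Mapping.lookup g e)" if "e \<in> Poly_Mapping.keys g" for e
    proof -
      have "d \<le> total_degree e" using d[OF g] that by (simp add: order_ge_def in_keys_iff)
      have "Poly_Mapping.lookup m i \<le> Poly_Mapping.lookup e i" for i
      proof -
        have "i = j" using j by auto
        then show ?thesis using \<open>d \<le> total_degree e\<close> deg_m by (simp add: total_degree_def j)
      qed
      then have "e = (e - m) + m" by (intro poly_mapping_eqI) (simp add: lookup_add lookup_minus)
      then have "Poly_Mapping.single e (Poly_Mapping.lookup g e) =
          Poly_Mapping.single m (Poly_Mapping.lookup f m) * Poly_Mapping.single (e - m) (Poly_Mapping.lookup g e / Poly_Mapping.lookup f m)"
        using m by (simp add: mult_single add.commute)
      then show ?thesis using f_single by (metis dvdI)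
    qed
    then show ?thesis by (subst sum_monomials[of g, symmetric]) (intro dvd_sum)
  qed
  then show False using principalideal_if_dvd[OF ideal f(1)] np by blast
qed

section \<open>Betti numbers of a homogeneous ideal\<close>

text \<open>
This is inherited from \<open>F\<close>, because constant vectors lift every vector over \<open>k\<close> to one over the polynomial
ring.
\<close>

lemma boundaries_subset_cycles:
  fixes D :: "nat \<Rightarrow> nat \<Rightarrow> nat \<Rightarrow> ('n::finite, 'k::field) mpoly"
  assumes "free_resolution mpoly_ring N b D e"
  shows "boundaries (field_module residue_map) b D (Suc i) \<subseteq> cycles (field_module residue_map) b D (Suc i)"
proof
  let ?res = "\<lambda>i p q. residue_map (D i p q)"
  fix v assume "v \<in> boundaries (field_module residue_map) b D (Suc i)"
  then obtain x where x: "x \<in> free_mod (b (Suc (Suc i)))"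
    "v = lin_map (b (Suc i)) (b (Suc (Suc i))) (?res (Suc i)) x"
    by (auto simp: boundaries_def dsum_field mat_act_field)
  obtain y :: "nat \<Rightarrow> ('n, 'k) mpoly" where y: "y \<in> free_mod (b (Suc (Suc i)))" "x = residue_vec y"
    using x(1) residue_vec_free_surj by blast
  let ?z = "lin_map (b (Suc i)) (b (Suc (Suc i))) (D (Suc i)) y"
  have "?z \<in> boundaries (regular_module mpoly_ring) b D (Suc i)"
    using y by (auto simp: boundaries_def dsum_regular mat_act_regular)
  then have "?z \<in> cycles (regular_module mpoly_ring) b D (Suc i)"
    using assms by (simp add: free_resolution_def)
  then have z: "lin_map (b i) (b (Suc i)) (D i) ?z = 0"
    by (simp add: cycles_def mat_act_regular zero_regular zero_fun_def)
  have v: "v = residue_vec ?z" using x y by (simp add: residue_vec_lin_map)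
  have "lin_map (b i) (b (Suc i)) (?res i) v = residue_vec (lin_map (b i) (b (Suc i)) (D i) ?z)"
    unfolding v by (simp add: residue_vec_lin_map)
  also have "\<dots> = 0" unfolding z by (auto simp: residue_vec_def residue_map_0)
  finally show "v \<in> cycles (field_module residue_map) b D (Suc i)"
    unfolding cycles_def using x lin_map_free
    by (simp add: dsum_field mat_act_field zero_fun_def) (simp add: field_module_def)
qed

lemma kdim_boundaries_less:
  assumes "free_resolution mpoly_ring N b D e"
    and "\<not> cycles (field_module residue_map) b D (Suc i) \<subseteq> boundaries (field_module residue_map) b D (Suc i)"
  shows "kdim (boundaries (field_module (residue_map :: ('n::finite, 'k::field) mpoly \<Rightarrow> 'k)) b D (Suc i))
    < kdim (cycles (field_module (residue_map :: ('n, 'k) mpoly \<Rightarrow> 'k)) b D (Suc i))"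
proof -
  let ?C = "cycles (field_module (residue_map :: ('n, 'k) mpoly \<Rightarrow> 'k)) b D (Suc i)"
  let ?B = "boundaries (field_module (residue_map :: ('n, 'k) mpoly \<Rightarrow> 'k)) b D (Suc i)"
  have z: "(\<lambda>_::nat. \<zero>\<^bsub>field_module (residue_map :: ('n, 'k) mpoly \<Rightarrow> 'k)\<^esub>) = 0"
    by (auto simp: field_module_def)
  have C: "?C = {v \<in> free_mod (b (Suc i)). lin_map (b i) (b (Suc i)) (\<lambda>p q. residue_map (D i p q)) v = 0}"
    unfolding cycles_def nat.case z dsum_field mat_act_field ..
  have B: "?B = lin_map (b (Suc i)) (b (Suc (Suc i))) (\<lambda>p q. residue_map (D (Suc i) p q)) ` free_mod (b (Suc (Suc i)))"
    unfolding boundaries_def dsum_field mat_act_field ..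
  obtain v where "v \<in> ?C" "v \<notin> ?B" using assms(2) by blast
  moreover have "submod ?C" unfolding C by (rule submod_kernel)
  moreover have "submod ?B" unfolding B by (intro submod_lin_image submod_free)
  moreover have "?C \<subseteq> free_mod (b (Suc i))" unfolding C by blast
  ultimately show ?thesis using boundaries_subset_cycles[OF assms(1)] by (intro kdim_less)
qed

text \<open>
The choice made by \<^const>\<open>tor_dim\<close> is a resolution because one exists, and \<open>tor_nonzero\<close> applies to
any resolution.
\<close>

lemma betti_positive:
  fixes I :: "('n::finite, 'k::field) mpoly set"
  assumes I: "homogeneous_ideal I" and np: "\<not> principalideal I mpoly_ring"
    and I0: "\<And>x. x \<in> I \<Longrightarrow> residue_map x = 0"
  shows "betti_over_poly I 1 > 0" "betti_over_poly I 2 > 0"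
proof -
  have ideal: "ideal I mpoly_ring" using I by (simp add: homogeneous_ideal_def)
  let ?P = "\<lambda>(b, D, e). free_resolution mpoly_ring (quotient_module mpoly_ring I) b D e"
  obtain b D e where some: "(SOME p. ?P p) = (b, D, e)" by (metis prod_cases3)
  have "\<exists>p. ?P p" using free_resolution_exists[OF ideal] by auto
  then have "?P (SOME p. ?P p)" by (rule someI_ex)
  then have res: "free_resolution mpoly_ring (quotient_module mpoly_ring I) b D e"
    unfolding some by simp
  have betti: "betti_over_poly I i = kdim (cycles (field_module (residue_map :: ('n, 'k) mpoly \<Rightarrow> 'k)) b D i)
      - kdim (boundaries (field_module (residue_map :: ('n, 'k) mpoly \<Rightarrow> 'k)) b D i)" for i
    unfolding betti_over_poly_def tor_dim_def some by simp
  obtain f g where fg: "f \<in> I" "f \<notin> irrelevant_power_times (*) 1 I"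
    "g \<in> I" "\<And>c. g - const_poly c * f \<notin> irrelevant_power_times (*) 1 I"
    using independent_generators_exist[OF I np] by blast
  note nz = tor_nonzero[OF ideal I0 fg res]
  show "betti_over_poly I 1 > 0"
    using kdim_boundaries_less[OF res, of 0] nz(1) by (simp add: betti)
  show "betti_over_poly I 2 > 0"
    using kdim_boundaries_less[OF res, of 1] nz(2) by (simp add: betti numeral_2_eq_2)
qed

text \<open>
The constant coefficient is a ring homomorphism whose kernel contains the variables, hence contains
the irrelevant ideal.
\<close>

lemma residue_map_ideal_prod:
  assumes "x \<in> ideal_prod mpoly_ring irrelevant_ideal irrelevant_ideal"
  shows "residue_map (x :: ('n::finite, 'k::field) mpoly) = 0"
proof -
  let ?J = "{x :: ('n, 'k) mpoly. residue_map x = 0}"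
  have "ring_hom_ring (mpoly_ring :: ('n, 'k) mpoly ring) (ring_of_type_algebra :: 'k ring) residue_map"
  proof (rule ring_hom_ringI2)
    show "residue_map \<in> ring_hom (mpoly_ring :: ('n, 'k) mpoly ring) (ring_of_type_algebra :: 'k ring)"
      by (rule ring_hom_memI) (auto simp: residue_map_mult residue_map_add residue_map_1)
  qed (rule ring_from_type_algebra)+
  then have "ideal (a_kernel (mpoly_ring :: ('n, 'k) mpoly ring) (ring_of_type_algebra :: 'k ring) residue_map) mpoly_ring"
    by (rule ring_hom_ring.kernel_is_ideal)
  moreover have "a_kernel (mpoly_ring :: ('n, 'k) mpoly ring) (ring_of_type_algebra :: 'k ring) residue_map = ?J"
    by (auto simp: a_kernel_def kernel_def)
  moreover have "range indet \<subseteq> ?J"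
  proof -
    have "Poly_Mapping.single j 1 \<noteq> (0 :: 'n \<Rightarrow>\<^sub>0 nat)" for j
      by (metis lookup_single_eq lookup_zero zero_neq_one)
    then show ?thesis by (auto simp: indet_def residue_map_def lookup_single when_def)
  qed
  ultimately have "irrelevant_ideal \<subseteq> ?J"
    unfolding irrelevant_ideal_def genideal_def by auto
  with assms show ?thesis
    by (induction rule: ideal_prod.induct) (auto simp: residue_map_mult residue_map_add)
qed

section \<open>Deviations of Golod rings\<close>

theorem theorem4p3:
  fixes I :: "('n::finite, 'k::field) mpoly set"
  assumes "homogeneous_ideal I"
    and "\<not> principalideal I mpoly_ring"
    and "I \<subseteq> ideal_prod mpoly_ring irrelevant_ideal irrelevant_ideal"
    and "golod I"
  shows "\<exists>\<rho>::real. \<rho> > 1 \<and>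
    (\<lambda>i. real_of_int (deviation I i) / (\<rho> ^ i / real i)) \<longlonglongrightarrow> 1"
proof -
  have "residue_map x = 0" if "x \<in> I" for x
    using assms(3) that by (intro residue_map_ideal_prod) blast
  then have "betti_over_poly I 1 > 0" "betti_over_poly I 2 > 0"
    using betti_positive[OF assms(1,2)] by blast+
  then show ?thesis
    by (rule golod_deviation_asymptotics[OF assms(4) card_variables_ge_2[OF assms(1,2)]])
qed

end
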